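(* Let $n\ge2$. The imprimitive reflection group $G(n,a,b,r)$, $[n,a,b,r]\in\Lambda_n$, has an additional system of imprimitivity given by $(1,q)\in\mathbb{H}^2$ in precisely the following cases: (a) $(1,j)$ and $(1,k)$, for the indices $[n,1,n,1]$; $[n,1,n,2]$ ($n$ odd); $[n,1,\frac n2,2]$ ($n$ even); and $[n,2,\frac n2,1]$ ($n$ even, $\frac n2$ odd); (b) $(1,1)$ and $(1,i)$, for the indices $[2,1,2,1]$ and $[2,1,1,2]$; and the infinite family (c) $(1,\alpha k)$, $-1<\alpha<1$, $\alpha\ne0$, for the indices $[n,1,n,1]$. Moreover, $G(n,1,n,1)$ is conjugate in $\mathrm{GL}(\mathbb{H}^2)$ to the complex reflection group $G(2n,n,2)$ (and so is counted as an imprimitive complex reflection group, not a quaternionic one). The other imprimitive quaternionic reflection groups for the dicyclic groups, $G(\mathcal{D}_n,\mathcal{D}_n,\mathcal{D}_n)$ ($n\ge 2$) and $G(\mathcal{D}_n,\mathcal{D}_n,\mathcal{D}_{n/2})$ ($n$ even, $n\ge4$), have no additional systems of imprimitivity.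
   Context: $\mathbb{H}$ denotes the quaternions with standard units $i,j,k$; $\mathbb{H}^2$ is a right vector space (matrices act on the left) with inner product $\langle v,w\rangle=\sum_j\overline{v_j}w_j$. A system of imprimitivity of a group $G\subset\mathrm{GL}(\mathbb{H}^2)$ is an unordered pair $\{V_1,V_2\}$ of one-dimensional subspaces with $\mathbb{H}^2=V_1\oplus V_2$ which is permuted by every element of $G$. The system given by $(1,q)$ is the pair consisting of the span of $(1,q)$ and its orthogonal complement, the span of $(-\overline{q},1)$. All $q$ are taken with $|q|\le 1$, which gives every orthogonal system, each once, except that for $|q|=1$ the vectors $(1,q)$ and $(1,-q)$ give the same system (only one of them is listed). "Additional" means other than the system given by the standard basis. For sets $\mathcal{L},\mathcal{H}$ of unit quaternions, $$\mathcal{G}(\mathcal{L},\mathcal{H}):=\Bigl\langle \bigl\{\begin{pmatrix}0&\beta\\ \overline{\beta}&0\end{pmatrix}\bigr\}_{\beta\in\mathcal{L}}\cup\bigl\{\begin{pmatrix}h&0\\0&1\end{pmatrix}\bigr\}_{h\in\mathcal{H}}\Bigr\rangle .$$ Let $\omega=e^{\pi i/n}$ (a primitive $2n$-th root of unity) and $\mathcal{D}_n=\langle\omega,j\rangle$ the dicyclic group of order $4n$. Let $$\Omega_n=\{(a,b):1\le a\le b\le n,\ a\mid n,\ b\mid n,\ \gcd(a,b)=1\},$$ $$\Lambda_n=\bigcup_{(a,b)\in\Omega_n}\{[n,a,b,\tfrac{n}{ab}]\}\ \cup\bigcup_{(a,b)\in\Omega_n,\ ab\text{ odd}}\{[n,a,b,\tfrac{2n}{ab}]\}.$$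 For $[n,a,b,r]\in\Lambda_n$, $$G(n,a,b,r):=\mathcal{G}(\{1,\omega^a,j,\omega^bj\},\{\omega^{2n/r}\}).$$ Only indices belonging to $\Lambda_n$ are meant in (a)–(c). Also $$G(\mathcal{D}_n,\mathcal{D}_n,\mathcal{D}_n)=\mathcal{G}(\{1,\omega,j,\omega j\},\{\omega,j\}),\qquad G(\mathcal{D}_n,\mathcal{D}_n,\mathcal{D}_{n/2})=\mathcal{G}(\{1,\omega,j,\omega j\},\{j\})\ (n\text{ even},\ n\ge4),$$ and, with the same $\omega=e^{\pi i/n}$, the complex reflection group is $G(2n,n,2)=\mathcal{G}(\{1,\omega\},\{-1\})$. *)

theory Defs
  imports "HOL-Analysis.Analysis" "HOL-Algebra.Generated_Groups"
begin

section \<open>Quaternions\<close>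

datatype quat = Quat (qRe: real) (qIm1: real) (qIm2: real) (qIm3: real)

lemma quat_eq_iff:
  "x = y \<longleftrightarrow> qRe x = qRe y \<and> qIm1 x = qIm1 y \<and> qIm2 x = qIm2 y \<and> qIm3 x = qIm3 y"
  by (cases x; cases y) auto

instantiation quat :: real_div_algebra
begin

definition "0 = Quat 0 0 0 0"
definition "1 = Quat 1 0 0 0"
definition "x + y = Quat (qRe x + qRe y) (qIm1 x + qIm1 y) (qIm2 x + qIm2 y) (qIm3 x + qIm3 y)"
definition "- x = Quat (- qRe x) (- qIm1 x) (- qIm2 x) (- qIm3 x)"
definition "x - y = Quat (qRe x - qRe y) (qIm1 x - qIm1 y) (qIm2 x - qIm2 y) (qIm3 x - qIm3 y)"
definition "t *\<^sub>R x = Quat (t * qRe x) (t * qIm1 x) (t * qIm2 x) (t * qIm3 x)"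
definition "x * y = Quat
  (qRe x * qRe y - qIm1 x * qIm1 y - qIm2 x * qIm2 y - qIm3 x * qIm3 y)
  (qRe x * qIm1 y + qIm1 x * qRe y + qIm2 x * qIm3 y - qIm3 x * qIm2 y)
  (qRe x * qIm2 y - qIm1 x * qIm3 y + qIm2 x * qRe y + qIm3 x * qIm1 y)
  (qRe x * qIm3 y + qIm1 x * qIm2 y - qIm2 x * qIm1 y + qIm3 x * qRe y)"
definition "inverse x =
  (1 / ((qRe x)\<^sup>2 + (qIm1 x)\<^sup>2 + (qIm2 x)\<^sup>2 + (qIm3 x)\<^sup>2)) *\<^sub>R
    Quat (qRe x) (- qIm1 x) (- qIm2 x) (- qIm3 x)"
definition "x div y = x * inverse (y :: quat)"

lemmas quat_defs = zero_quat_def one_quat_def plus_quat_def uminus_quat_def minus_quat_def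
  scaleR_quat_def times_quat_def inverse_quat_def divide_quat_def

lemma quat_norm_pos:
  assumes "x \<noteq> 0"
  shows "(qRe x)\<^sup>2 + (qIm1 x)\<^sup>2 + (qIm2 x)\<^sup>2 + (qIm3 x)\<^sup>2 > 0"
proof -
  have "qRe x \<noteq> 0 \<or> qIm1 x \<noteq> 0 \<or> qIm2 x \<noteq> 0 \<or> qIm3 x \<noteq> 0"
    using assms by (auto simp: quat_eq_iff zero_quat_def)
  then have "(qRe x)\<^sup>2 > 0 \<or> (qIm1 x)\<^sup>2 > 0 \<or> (qIm2 x)\<^sup>2 > 0 \<or> (qIm3 x)\<^sup>2 > 0"
    by simp
  moreover have "(qRe x)\<^sup>2 \<ge> 0" "(qIm1 x)\<^sup>2 \<ge> 0" "(qIm2 x)\<^sup>2 \<ge> 0" "(qIm3 x)\<^sup>2 \<ge> 0" by simp_all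
  ultimately show ?thesis by linarith
qed

instance
proof
  fix x y z :: quat and s t :: real
  show "x \<noteq> 0 \<Longrightarrow> inverse x * x = 1" "x \<noteq> 0 \<Longrightarrow> x * inverse x = 1"
    using quat_norm_pos[of x]
    by (simp_all add: quat_eq_iff quat_defs divide_simps power2_eq_square)
qed (simp_all add: quat_eq_iff quat_defs algebra_simps)

end

definition qi :: quat where "qi = Quat 0 1 0 0"
definition qj :: quat where "qj = Quat 0 0 1 0"
definition qk :: quat where "qk = Quat 0 0 0 1"

lemma quat_units: "qi * qi = -1" "qj * qj = -1" "qk * qk = -1" "qi * qj * qk = -1"
  by (simp_all add: quat_eq_iff quat_defs qi_def qj_def qk_def)

definition qcnj :: "quat \<Rightarrow> quat" where
  "qcnj x = Quat (qRe x) (- qIm1 x) (- qIm2 x) (- qIm3 x)"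

definition quat_of_complex :: "complex \<Rightarrow> quat" where
  "quat_of_complex z = Quat (Re z) (Im z) 0 0"


section \<open>Lines in the right quaternionic plane and systems of imprimitivity\<close>

definition rscale :: "quat^2 \<Rightarrow> quat \<Rightarrow> quat^2" (infixl "*r" 75) where
  "v *r q = (\<chi> l. v $ l * q)"

definition rspan :: "quat^2 \<Rightarrow> (quat^2) set" where
  "rspan v = range (\<lambda>q. v *r q)"

definition is_line :: "(quat^2) set \<Rightarrow> bool" where
  "is_line V \<longleftrightarrow> (\<exists>v. v \<noteq> 0 \<and> V = rspan v)"

definition qinner :: "quat^2 \<Rightarrow> quat^2 \<Rightarrow> quat" where
  "qinner v w = (\<Sum>l\<in>UNIV. qcnj (v $ l) * w $ l)"

definition orth_compl :: "(quat^2) set \<Rightarrow> (quat^2) set" where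
  "orth_compl V = {w. \<forall>v\<in>V. qinner v w = 0}"

definition is_direct_sum :: "(quat^2) set \<Rightarrow> (quat^2) set \<Rightarrow> bool" where
  "is_direct_sum V W \<longleftrightarrow> (\<forall>x. \<exists>v\<in>V. \<exists>w\<in>W. x = v + w) \<and> V \<inter> W = {0}"

definition system_of_imprimitivity :: "(quat^2^2) set \<Rightarrow> (quat^2) set set \<Rightarrow> bool" where
  "system_of_imprimitivity G S \<longleftrightarrow>
     (\<exists>V W. S = {V, W} \<and> is_line V \<and> is_line W \<and> is_direct_sum V W) \<and>
     (\<forall>g\<in>G. (\<lambda>V. ((*v) g) ` V) ` S = S)"

definition standard_system :: "(quat^2) set set" where
  "standard_system = {rspan (vector [1, 0]), rspan (vector [0, 1])}"

definition additional_system :: "(quat^2^2) set \<Rightarrow> (quat^2) set set \<Rightarrow> bool" where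
  "additional_system G S \<longleftrightarrow> system_of_imprimitivity G S \<and> S \<noteq> standard_system"

definition system_given_by :: "quat \<Rightarrow> (quat^2) set set" where
  "system_given_by q = {rspan (vector [1, q]), orth_compl (rspan (vector [1, q]))}"

lemma orth_compl_rspan: "orth_compl (rspan (vector [1, q])) = rspan (vector [- qcnj q, 1])"
proof -
  have cnj1: "qcnj (x * y) = qcnj y * qcnj x" for x y
    by (simp add: quat_eq_iff quat_defs qcnj_def algebra_simps)
  have one: "qcnj 1 = 1" by (simp add: quat_eq_iff quat_defs qcnj_def)
  have inner: "qinner (vector [1, q] *r p) w = qcnj p * (w $ 1 + qcnj q * w $ 2)" for p w
    by (simp add: qinner_def rscale_def sum_2 cnj1 one distrib_left mult.assoc)
  have "w \<in> orth_compl (rspan (vector [1, q])) \<longleftrightarrow> w $ 1 + qcnj q * w $ 2 = 0" for w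
  proof
    assume "w \<in> orth_compl (rspan (vector [1, q]))"
    then have "qinner (vector [1, q] *r 1) w = 0"
      unfolding orth_compl_def rspan_def by blast
    then show "w $ 1 + qcnj q * w $ 2 = 0" by (simp add: inner one)
  qed (auto simp: orth_compl_def rspan_def inner)
  moreover have "w \<in> rspan (vector [- qcnj q, 1]) \<longleftrightarrow> w $ 1 + qcnj q * w $ 2 = 0" for w
    by (auto simp: rspan_def rscale_def vec_eq_iff forall_2 image_iff add_eq_0_iff2)
  ultimately show ?thesis by blast
qed


section \<open>The groups\<close>

definition GL2H :: "(quat^2^2) monoid" where
  "GL2H = \<lparr>carrier = {A. invertible A}, mult = (**), one = mat 1\<rparr>"

lemma group_GL2H: "group GL2H"
proof (rule groupI)
  fix A assume "A \<in> carrier GL2H"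
  then obtain B where "A ** B = mat 1" "B ** A = mat 1"
    by (auto simp: GL2H_def invertible_def)
  then show "\<exists>B\<in>carrier GL2H. B \<otimes>\<^bsub>GL2H\<^esub> A = \<one>\<^bsub>GL2H\<^esub>"
    by (auto simp: GL2H_def invertible_def)
next
  fix A B assume "A \<in> carrier GL2H" "B \<in> carrier GL2H"
  then obtain A' B' where inv: "A ** A' = mat 1" "A' ** A = mat 1" "B ** B' = mat 1" "B' ** B = mat 1"
    by (auto simp: GL2H_def invertible_def)
  have "(A ** B) ** (B' ** A') = A ** (B ** B') ** A'" "(B' ** A') ** (A ** B) = B' ** (A' ** A) ** B"
    by (simp_all add: matrix_mul_assoc)
  with inv show "A \<otimes>\<^bsub>GL2H\<^esub> B \<in> carrier GL2H"
    by (auto simp: GL2H_def invertible_def)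
next
  show "\<one>\<^bsub>GL2H\<^esub> \<in> carrier GL2H"
    by (auto simp: GL2H_def invertible_def intro!: exI[of _ "mat 1"])
qed (auto simp: GL2H_def matrix_mul_assoc)

definition antidiag :: "quat \<Rightarrow> quat^2^2" where
  "antidiag \<beta> = vector [vector [0, \<beta>], vector [qcnj \<beta>, 0]]"

definition diag1 :: "quat \<Rightarrow> quat^2^2" where
  "diag1 h = vector [vector [h, 0], vector [0, 1]]"

lemma generators_in_GL2H:
  shows "\<beta> * qcnj \<beta> = 1 \<Longrightarrow> antidiag \<beta> \<in> carrier GL2H"
    and "h * qcnj h = 1 \<Longrightarrow> diag1 h \<in> carrier GL2H"
proof -
  have comm: "x * qcnj x = qcnj x * x" for x
    by (simp add: quat_eq_iff quat_defs qcnj_def algebra_simps)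
  show "\<beta> * qcnj \<beta> = 1 \<Longrightarrow> antidiag \<beta> \<in> carrier GL2H"
    using comm[of \<beta>] by (auto simp: GL2H_def invertible_def antidiag_def vec_eq_iff forall_2
        matrix_matrix_mult_def sum_2 mat_def intro!: exI[of _ "antidiag \<beta>"])
  show "h * qcnj h = 1 \<Longrightarrow> diag1 h \<in> carrier GL2H"
    using comm[of h] by (auto simp: GL2H_def invertible_def diag1_def vec_eq_iff forall_2
        matrix_matrix_mult_def sum_2 mat_def intro!: exI[of _ "diag1 (qcnj h)"])
qed

definition group_LH :: "quat set \<Rightarrow> quat set \<Rightarrow> (quat^2^2) set" where
  "group_LH L H = generate GL2H (antidiag ` L \<union> diag1 ` H)"

definition conjugate_in_GL :: "(quat^2^2) set \<Rightarrow> (quat^2^2) set \<Rightarrow> bool" where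
  "conjugate_in_GL G G' \<longleftrightarrow>
     (\<exists>P\<in>carrier GL2H. G' = (\<lambda>g. P \<otimes>\<^bsub>GL2H\<^esub> g \<otimes>\<^bsub>GL2H\<^esub> inv\<^bsub>GL2H\<^esub> P) ` G)"

definition omega :: "nat \<Rightarrow> quat" where
  "omega n = quat_of_complex (exp (of_real pi * \<i> / of_nat n))"

definition Omega_set :: "nat \<Rightarrow> (nat \<times> nat) set" where
  "Omega_set n = {(a, b). 1 \<le> a \<and> a \<le> b \<and> b \<le> n \<and> a dvd n \<and> b dvd n \<and> gcd a b = 1}"

text \<open>The divisions below are exact, because coprime divisors \<open>a\<close>, \<open>b\<close> of \<open>n\<close> satisfy
  \<open>a * b dvd n\<close>; likewise every \<open>r\<close> occurring here divides \<open>2 * n\<close>.\<close>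

definition Lambda_set :: "nat \<Rightarrow> (nat \<times> nat \<times> nat \<times> nat) set" where
  "Lambda_set n =
     {(n, a, b, n div (a * b)) | a b. (a, b) \<in> Omega_set n} \<union>
     {(n, a, b, 2 * n div (a * b)) | a b. (a, b) \<in> Omega_set n \<and> odd (a * b)}"

lemma Lambda_set_exact:
  assumes "(a, b) \<in> Omega_set n"
  shows "a * b dvd n" "n div (a * b) dvd 2 * n" "2 * n div (a * b) dvd 2 * n"
proof -
  show ab: "a * b dvd n"
    using assms by (auto simp: Omega_set_def coprime_iff_gcd_eq_1 intro: divides_mult)
  then show "n div (a * b) dvd 2 * n" "2 * n div (a * b) dvd 2 * n"
    by (metis dvd_div_mult_self dvd_mult dvd_triv_left)+
qed

definition G_nabr :: "nat \<Rightarrow> nat \<Rightarrow> nat \<Rightarrow> nat \<Rightarrow> (quat^2^2) set" where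
  "G_nabr n a b r =
     group_LH {1, omega n ^ a, qj, omega n ^ b * qj} {omega n ^ (2 * n div r)}"

text \<open>\<open>G_DDD n\<close> and \<open>G_DDD_half n\<close> are $G(D_n, D_n, D_n)$ and $G(D_n, D_n, D_{n/2})$ for the
  dicyclic groups $D_n = \langle \omega, j \rangle$; \<open>G_complex n\<close> is the complex
  reflection group $G(2n, n, 2)$.\<close>

definition G_DDD :: "nat \<Rightarrow> (quat^2^2) set" where
  "G_DDD n = group_LH {1, omega n, qj, omega n * qj} {omega n, qj}"

definition G_DDD_half :: "nat \<Rightarrow> (quat^2^2) set" where
  "G_DDD_half n = group_LH {1, omega n, qj, omega n * qj} {qj}"

definition G_complex :: "nat \<Rightarrow> (quat^2^2) set" where
  "G_complex n = group_LH {1, omega n} {- 1}"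

end

theory Submission
  imports Defs
begin

text \<open>
  Apart from \<open>line_infinity\<close>, every line of \<open>quat^2\<close> is spanned by some \<open>(1, x)\<close>, so
  lines are governed by their slope \<open>x\<close>. On slopes the generators act by the simple maps
  \<open>x \<mapsto> qcnj \<beta> * inverse x * qcnj \<beta>\<close> (the antidiagonal ones) and \<open>x \<mapsto> x * qcnj h\<close>
  (the diagonal ones). All groups considered contain the swap of the coordinates, which
  exchanges the two coordinate axes; hence an additional system consists of two lines of
  distinct nonzero slopes \<open>x\<close>, \<open>y\<close>, and the task is to find the pairs \<open>{x, y}\<close> which are
  stable under the maps of all generators (\<open>additional_system_iff\<close>).

  The swap inverts slopes, so either both are \<open>\<plusminus>1\<close> or \<open>y = inverse x\<close>. The generator with
  \<open>\<beta> = j\<close> then forces \<open>x = \<plusminus>j\<close> or \<open>x\<close> in the span of \<open>i\<close> and \<open>k\<close>, and one with a complex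
  \<open>\<beta>\<close>, \<open>\<beta>\<^sup>2 \<noteq> 1\<close>, leaves only \<open>\<plusminus>i\<close> and the real multiples of \<open>k\<close> in the second case. This is
  \<open>invariant_pair_cases\<close>. The four kinds of candidates are orthogonal systems, and it
  remains to test each of them against the generators. For the symbols
  \<open>{1, z, j, w j}\<close> the answer depends only on \<open>z\<^sup>2\<close>, \<open>w\<^sup>2\<close> and on the diagonal part \<open>H\<close> being
  contained in \<open>{1, -1}\<close> or in \<open>{1}\<close> (\<open>additional_system_complex_j_iff\<close>). Since \<open>\<omega>\<close> is a
  primitive \<open>2n\<close>-th root of unity, these conditions turn into divisibility conditions on
  \<open>a\<close>, \<open>b\<close>, \<open>r\<close>, which \<open>Lambda_indices\<close> solves. The two groups with \<open>j \<in> H\<close> fail all of them.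

  The conjugacy is given by an explicit matrix, which centralizes every antidiagonal
  reflection with a complex entry and carries \<open>antidiag qj\<close> to \<open>diag1 (- 1)\<close>; the generator
  \<open>antidiag (- qj)\<close> is conjugate to \<open>antidiag qj\<close> under the swap.
\<close>

section \<open>Quaternions\<close>

lemma qcnj_mult: "qcnj (x * y) = qcnj y * qcnj x"
  by (simp add: quat_eq_iff quat_defs qcnj_def algebra_simps)

lemma unit_quat_commute: "x * qcnj x = 1 \<longleftrightarrow> qcnj x * x = 1"
  by (simp add: quat_eq_iff quat_defs qcnj_def algebra_simps)

lemma unit_quat_norm: "x * qcnj x = 1 \<longleftrightarrow> (qRe x)\<^sup>2 + (qIm1 x)\<^sup>2 + (qIm2 x)\<^sup>2 + (qIm3 x)\<^sup>2 = 1"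
  by (simp add: quat_eq_iff quat_defs qcnj_def algebra_simps power2_eq_square)

lemma unit_quat_inverse:
  assumes "x * qcnj x = 1"
  shows "inverse x = qcnj x" "x \<noteq> 0" "qcnj x \<noteq> 0"
  using assms by (auto intro: inverse_unique)

lemma unit_quat_cancel:
  assumes "x * qcnj x = 1"
  shows "x * (qcnj x * y) = y" "qcnj x * (x * y) = y"
  using assms unit_quat_commute[of x] by (simp_all flip: mult.assoc)

lemma quat_units_comps:
  "qRe qi = 0" "qIm1 qi = 1" "qIm2 qi = 0" "qIm3 qi = 0"
  "qRe qj = 0" "qIm1 qj = 0" "qIm2 qj = 1" "qIm3 qj = 0"
  "qRe qk = 0" "qIm1 qk = 0" "qIm2 qk = 0" "qIm3 qk = 1"
  by (simp_all add: qi_def qj_def qk_def)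

text \<open>Identities between explicit quaternions are decided by comparing coordinates, which these
  rules expose.\<close>

lemmas quat_calc = quat_eq_iff quat_defs quat_units_comps qcnj_def quat_of_complex_def

lemma unit_quat_units:
  "1 * qcnj 1 = 1" "qi * qcnj qi = 1" "qj * qcnj qj = 1" "qk * qcnj qk = 1"
  by (simp_all add: quat_calc)

lemma quat_of_complex_mult: "quat_of_complex (z * w) = quat_of_complex z * quat_of_complex w"
  by (simp add: quat_calc)

lemma quat_of_complex_one: "quat_of_complex 1 = 1"
  by (simp add: quat_calc)

lemma quat_of_complex_power: "quat_of_complex z ^ m = quat_of_complex (z ^ m)"
  by (induction m) (simp_all add: quat_of_complex_mult quat_of_complex_one)

lemma quat_of_complex_eq_1_iff: "quat_of_complex z = 1 \<longleftrightarrow> z = 1"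
  by (simp add: quat_calc complex_eq_iff)

lemma quat_of_complex_eq_m1_iff: "quat_of_complex z = -1 \<longleftrightarrow> z = -1"
  by (simp add: quat_calc complex_eq_iff)

lemma unit_quat_complex:
  assumes "cmod z = 1"
  shows "quat_of_complex z * qcnj (quat_of_complex z) = 1"
  using assms cmod_power2[of z] by (simp add: unit_quat_norm quat_of_complex_def)

lemma unit_quat_mult:
  assumes "x * qcnj x = 1" "y * qcnj y = 1"
  shows "(x * y) * qcnj (x * y) = 1"
  using assms by (simp add: qcnj_mult mult.assoc unit_quat_cancel)

section \<open>Lines of the quaternionic plane\<close>

text \<open>Scalars act on the right, so the slope of the line through \<open>v\<close> is \<open>v $ 2 * inverse (v $ 1)\<close>,
  in this order; \<open>line_infinity\<close> takes the place of infinite slope.\<close>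

definition line :: "quat \<Rightarrow> (quat^2) set" where
  "line x = rspan (vector [1, x])"

definition line_infinity :: "(quat^2) set" where
  "line_infinity = rspan (vector [0, 1])"

lemma mem_line: "v \<in> line x \<longleftrightarrow> v $ 2 = x * v $ 1"
  by (auto simp: line_def rspan_def rscale_def vec_eq_iff forall_2 image_iff)

lemma mem_line_infinity: "v \<in> line_infinity \<longleftrightarrow> v $ 1 = 0"
  by (auto simp: line_infinity_def rspan_def rscale_def vec_eq_iff forall_2 image_iff)

lemma line_eq_iff: "line x = line y \<longleftrightarrow> x = y"
proof
  assume "line x = line y"
  moreover have "vector [1, x] \<in> line x" by (simp add: mem_line)
  ultimately have "vector [1, x] \<in> line y" by simp
  then show "x = y" by (simp add: mem_line)
qed simp

lemma line_neq_infinity: "line x \<noteq> line_infinity" "line_infinity \<noteq> line x"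
proof -
  have "vector [1, x] \<in> line x" "vector [1, x] \<notin> line_infinity"
    by (simp_all add: mem_line mem_line_infinity)
  then show "line x \<noteq> line_infinity" "line_infinity \<noteq> line x" by blast+
qed

lemma is_line_line: "is_line (line x)"
  unfolding is_line_def line_def by (rule exI[of _ "vector [1, x]"]) (simp add: vec_eq_iff forall_2)

lemma rspan_vector:
  assumes "p \<noteq> 0"
  shows "rspan (vector [p, q]) = line (q * inverse p)"
proof (rule Set.set_eqI)
  fix v
  have "v \<in> rspan (vector [p, q]) \<longleftrightarrow> (\<exists>t. v $ 1 = p * t \<and> v $ 2 = q * t)"
    by (auto simp: rspan_def rscale_def vec_eq_iff forall_2 image_iff)
  also have "\<dots> \<longleftrightarrow> v $ 2 = q * inverse p * v $ 1"
  proof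
    assume "v $ 2 = q * inverse p * v $ 1"
    with assms show "\<exists>t. v $ 1 = p * t \<and> v $ 2 = q * t"
      by (intro exI[of _ "inverse p * v $ 1"]) (simp add: mult.assoc[symmetric])
  next
    assume "\<exists>t. v $ 1 = p * t \<and> v $ 2 = q * t"
    then obtain t where t: "v $ 1 = p * t" "v $ 2 = q * t" by blast
    have "q * inverse p * (p * t) = q * ((inverse p * p) * t)" by (simp only: mult.assoc)
    with t assms show "v $ 2 = q * inverse p * v $ 1" by simp
  qed
  finally show "v \<in> rspan (vector [p, q]) \<longleftrightarrow> v \<in> line (q * inverse p)"
    by (simp add: mem_line)
qed

lemma is_line_cases:
  assumes "is_line V"
  obtains "V = line_infinity" | x where "V = line x"
proof -
  obtain v where v: "v \<noteq> 0" "V = rspan v" using assms by (auto simp: is_line_def)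
  have vv: "v = vector [v $ 1, v $ 2]" by (simp add: vec_eq_iff forall_2)
  show thesis
  proof (cases "v $ 1 = 0")
    case False
    then show ?thesis using rspan_vector[OF False, of "v $ 2"] v vv that by metis
  next
    case True
    then have nz: "v $ 2 \<noteq> 0" using v by (auto simp: vec_eq_iff forall_2)
    have "w \<in> V \<longleftrightarrow> w $ 1 = 0" for w
    proof -
      have "\<exists>t. w $ 2 = v $ 2 * t"
        using nz by (intro exI[of _ "inverse (v $ 2) * w $ 2"]) (simp flip: mult.assoc)
      then show ?thesis
        using True by (auto simp: v rspan_def rscale_def vec_eq_iff forall_2 image_iff)
    qed
    then have "V = line_infinity" by (simp add: Set.set_eq_iff mem_line_infinity)
    then show ?thesis by (rule that)
  qed
qed

lemma standard_system_eq: "standard_system = {line 0, line_infinity}"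
  by (simp add: standard_system_def line_def line_infinity_def)

lemma is_direct_sum_lines:
  assumes "x \<noteq> y"
  shows "is_direct_sum (line x) (line y)"
  unfolding is_direct_sum_def
proof (intro conjI allI)
  fix u :: "quat^2"
  \<comment> \<open>The first coordinate of the component in \<open>line x\<close>, found by solving \<open>x s + y (u\<^sub>1 - s) = u\<^sub>2\<close>.\<close>
  define s where "s = inverse (x - y) * (u $ 2 - y * u $ 1)"
  have s: "x * s - y * s = u $ 2 - y * u $ 1"
    using assms by (simp add: s_def flip: left_diff_distrib mult.assoc)
  have "vector [s, x * s] \<in> line x"
    "vector [u $ 1 - s, y * (u $ 1 - s)] \<in> line y"
    by (simp_all add: mem_line)
  moreover have "u = vector [s, x * s] + vector [u $ 1 - s, y * (u $ 1 - s)]"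
    using s by (simp add: vec_eq_iff forall_2 algebra_simps)
  ultimately show "\<exists>v\<in>line x. \<exists>w\<in>line y. u = v + w" by blast
next
  have "v = 0" if "v $ 2 = x * v $ 1" "v $ 2 = y * v $ 1" for v :: "quat^2"
  proof -
    have "(x - y) * v $ 1 = 0" using that by (simp only: left_diff_distrib) simp
    then have "v $ 1 = 0" using assms by simp
    with that show ?thesis by (simp add: vec_eq_iff forall_2)
  qed
  then show "line x \<inter> line y = {0}" by (auto simp: mem_line)
qed

lemma system_given_by_eq:
  assumes "q \<noteq> 0"
  shows "system_given_by q = {line q, line (inverse (- qcnj q))}"
proof -
  have "- qcnj q \<noteq> 0" using assms by (auto simp: quat_calc)
  then show ?thesis
    using rspan_vector[of "- qcnj q" 1]
    by (simp add: system_given_by_def orth_compl_rspan line_def)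
qed

section \<open>The action of the generators on lines\<close>

text \<open>Images of lines become preimages under the inverse matrix, for which membership is an
  equation instead of an existence statement.\<close>

lemma image_matrix_vector:
  fixes A B :: "quat^2^2"
  assumes "A ** B = mat 1" "B ** A = mat 1"
  shows "((*v) A) ` V = {u. B *v u \<in> V}"
proof (intro Set.set_eqI iffI)
  fix u assume "u \<in> ((*v) A) ` V"
  then show "u \<in> {u. B *v u \<in> V}"
    using assms by (auto simp: matrix_vector_mul_assoc)
next
  fix u assume "u \<in> {u. B *v u \<in> V}"
  moreover have "u = A *v (B *v u)" using assms by (simp add: matrix_vector_mul_assoc)
  ultimately show "u \<in> ((*v) A) ` V" by blast
qed

lemma antidiag_mult_vec: "antidiag \<beta> *v u = vector [\<beta> * u $ 2, qcnj \<beta> * u $ 1]"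
  by (simp add: antidiag_def vec_eq_iff forall_2 matrix_vector_mult_def sum_2)

lemma diag1_mult_vec: "diag1 h *v u = vector [h * u $ 1, u $ 2]"
  by (simp add: diag1_def vec_eq_iff forall_2 matrix_vector_mult_def sum_2)

lemma antidiag_involution:
  assumes "\<beta> * qcnj \<beta> = 1"
  shows "antidiag \<beta> ** antidiag \<beta> = mat 1"
  using assms unit_quat_commute[of \<beta>]
  by (simp add: antidiag_def vec_eq_iff forall_2 matrix_matrix_mult_def sum_2 mat_def)

lemma diag1_inverse:
  assumes "h * qcnj h = 1"
  shows "diag1 h ** diag1 (qcnj h) = mat 1" "diag1 (qcnj h) ** diag1 h = mat 1"
  using assms unit_quat_commute[of h]
  by (simp_all add: diag1_def vec_eq_iff forall_2 matrix_matrix_mult_def sum_2 mat_def)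

text \<open>The effect of \<open>antidiag \<beta>\<close>, for a unit \<open>\<beta>\<close>, on nonzero slopes.\<close>

definition antidiag_slope :: "quat \<Rightarrow> quat \<Rightarrow> quat" where
  "antidiag_slope \<beta> x = qcnj \<beta> * inverse x * qcnj \<beta>"

lemma antidiag_line:
  assumes "\<beta> * qcnj \<beta> = 1" "x \<noteq> 0"
  shows "((*v) (antidiag \<beta>)) ` line x = line (antidiag_slope \<beta> x)"
proof (rule Set.set_eqI)
  fix u
  have "u \<in> ((*v) (antidiag \<beta>)) ` line x \<longleftrightarrow> qcnj \<beta> * u $ 1 = x * (\<beta> * u $ 2)"
    unfolding image_matrix_vector[OF antidiag_involution[OF assms(1)] antidiag_involution[OF assms(1)]]
    by (simp add: antidiag_mult_vec mem_line)
  also have "\<dots> \<longleftrightarrow> qcnj \<beta> * (inverse x * (qcnj \<beta> * u $ 1)) = qcnj \<beta> * (inverse x * (x * (\<beta> * u $ 2)))"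
    using assms(2) unit_quat_inverse[OF assms(1)] by simp
  also have "qcnj \<beta> * (inverse x * (x * (\<beta> * u $ 2))) = u $ 2"
    using assms(2) unit_quat_cancel[OF assms(1)] by (simp add: mult.assoc[symmetric, of "inverse x"])
  finally show "u \<in> ((*v) (antidiag \<beta>)) ` line x \<longleftrightarrow> u \<in> line (antidiag_slope \<beta> x)"
    by (auto simp: mem_line antidiag_slope_def mult.assoc)
qed

lemma antidiag_line_0:
  assumes "\<beta> * qcnj \<beta> = 1"
  shows "((*v) (antidiag \<beta>)) ` line 0 = line_infinity"
    "((*v) (antidiag \<beta>)) ` line_infinity = line 0"
  unfolding image_matrix_vector[OF antidiag_involution[OF assms] antidiag_involution[OF assms]]
  using unit_quat_inverse[OF assms]
  by (auto simp: antidiag_mult_vec mem_line mem_line_infinity)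

lemma diag1_line:
  assumes "h * qcnj h = 1"
  shows "((*v) (diag1 h)) ` line x = line (x * qcnj h)"
  unfolding image_matrix_vector[OF diag1_inverse[OF assms]]
  by (auto simp: diag1_mult_vec mem_line mult.assoc)

text \<open>The matrices that permute a given system form a group, so it is enough to test generators.\<close>

lemma system_of_imprimitivity_generate:
  assumes "X \<subseteq> carrier GL2H"
  shows "system_of_imprimitivity (generate GL2H X) S \<longleftrightarrow>
    (\<exists>V W. S = {V, W} \<and> is_line V \<and> is_line W \<and> is_direct_sum V W) \<and>
    (\<forall>g\<in>X. (\<lambda>V. ((*v) g) ` V) ` S = S)"
proof -
  interpret group GL2H by (rule group_GL2H)
  let ?a = "\<lambda>g :: quat^2^2. \<lambda>V. ((*v) g) ` V"
  have comp: "?a (A ** B) ` S = ?a A ` (?a B ` S)" for A B S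
    by (auto simp: image_image matrix_vector_mul_assoc)
  have one: "?a (mat 1) ` S = S" for S
    by simp
  have stab: "?a g ` S = S" if X: "\<forall>g\<in>X. ?a g ` S = S" and "g \<in> generate GL2H X" for g
    using that(2)
  proof induction
    case one
    then show ?case using one by (simp add: GL2H_def)
  next
    case (incl h)
    then show ?case using X by blast
  next
    case (inv h)
    then have "inv\<^bsub>GL2H\<^esub> h \<otimes>\<^bsub>GL2H\<^esub> h = \<one>\<^bsub>GL2H\<^esub>" using assms by auto
    then have "inv\<^bsub>GL2H\<^esub> h ** h = mat 1" by (simp add: GL2H_def)
    with comp[of "inv\<^bsub>GL2H\<^esub> h" h S] one[of S] X inv show ?case by simp
  next
    case (eng h1 h2)
    then show ?case using comp[of h1 h2 S] by (simp add: GL2H_def)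
  qed
  have "(\<forall>g\<in>generate GL2H X. ?a g ` S = S) \<longleftrightarrow> (\<forall>g\<in>X. ?a g ` S = S)"
    by (intro iffI ballI) (simp add: generate.incl, rule stab)
  then show ?thesis by (simp only: system_of_imprimitivity_def)
qed

text \<open>The coordinate axes are exchanged by \<open>antidiag 1\<close>. A system that contains one of them
  therefore contains both and is the standard one, so in an additional system both lines have
  nonzero slopes and the action on slopes applies.\<close>

lemma additional_system_iff:
  assumes L: "1 \<in> L" "\<And>\<beta>. \<beta> \<in> L \<Longrightarrow> \<beta> * qcnj \<beta> = 1"
    and H: "\<And>h. h \<in> H \<Longrightarrow> h * qcnj h = 1"
  shows "additional_system (group_LH L H) S \<longleftrightarrow>
    (\<exists>x y. S = {line x, line y} \<and> x \<noteq> y \<and> x \<noteq> 0 \<and> y \<noteq> 0 \<and>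
      (\<forall>\<beta>\<in>L. antidiag_slope \<beta> ` {x, y} = {x, y}) \<and> (\<forall>h\<in>H. (\<lambda>x. x * qcnj h) ` {x, y} = {x, y}))"
    (is "?A \<longleftrightarrow> ?B")
proof -
  let ?a = "\<lambda>g :: quat^2^2. \<lambda>V. ((*v) g) ` V"
  have X: "antidiag ` L \<union> diag1 ` H \<subseteq> carrier GL2H"
    using generators_in_GL2H L H by auto
  have lines: "{line x, line y} = {line x', line y'} \<longleftrightarrow> {x, y} = {x', y'}" for x y x' y'
    by (auto simp: doubleton_eq_iff line_eq_iff)
  note sys = system_of_imprimitivity_generate[OF X, folded group_LH_def]
  have inv_iff: "(\<forall>g\<in>antidiag ` L \<union> diag1 ` H. ?a g ` {line x, line y} = {line x, line y}) \<longleftrightarrow>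
      (\<forall>\<beta>\<in>L. antidiag_slope \<beta> ` {x, y} = {x, y}) \<and> (\<forall>h\<in>H. (\<lambda>x. x * qcnj h) ` {x, y} = {x, y})"
    if "x \<noteq> 0" "y \<noteq> 0" for x y
    using that L H by (simp add: ball_Un antidiag_line diag1_line lines)
  show ?thesis
  proof
    assume A: ?A
    then obtain V W where VW: "S = {V, W}" "is_line V" "is_line W" "is_direct_sum V W"
      by (auto simp: additional_system_def sys)
    have ns: "S \<noteq> {line 0, line_infinity}"
      using A by (simp add: additional_system_def standard_system_eq)
    have inv: "\<forall>g\<in>antidiag ` L \<union> diag1 ` H. ?a g ` S = S"
      using A by (simp add: additional_system_def sys)
    then have "?a (antidiag 1) ` S = S" using L by blast
    then have im: "\<And>U. U \<in> S \<Longrightarrow> ?a (antidiag 1) U \<in> S" by blast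
    have one: "1 * qcnj 1 = 1" using L by blast
    have no0: "line 0 \<notin> S"
    proof
      assume "line 0 \<in> S"
      with im[OF this] antidiag_line_0[OF one] have "line_infinity \<in> S" by simp
      with \<open>line 0 \<in> S\<close> ns line_neq_infinity[of 0] show False by (auto simp: VW(1))
    qed
    moreover have "line_infinity \<notin> S"
      using im[of line_infinity] no0 antidiag_line_0[OF one] by auto
    ultimately obtain x y where xy: "V = line x" "W = line y" "x \<noteq> 0" "y \<noteq> 0"
      using VW by (metis insertCI is_line_cases)
    have "x \<noteq> y"
    proof
      assume "x = y"
      then have "vector [1, x] \<in> V \<inter> W" by (simp add: xy mem_line)
      then have "vector [1, x] = (0 :: quat^2)" using VW(4) by (auto simp: is_direct_sum_def)
      then show False by (simp add: vec_eq_iff forall_2)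
    qed
    with xy VW(1) inv inv_iff[OF xy(3,4)] show ?B by blast
  next
    assume ?B
    then obtain x y where xy: "S = {line x, line y}" "x \<noteq> y" "x \<noteq> 0" "y \<noteq> 0"
      and "(\<forall>\<beta>\<in>L. antidiag_slope \<beta> ` {x, y} = {x, y}) \<and> (\<forall>h\<in>H. (\<lambda>x. x * qcnj h) ` {x, y} = {x, y})"
      by blast
    then have "\<forall>g\<in>antidiag ` L \<union> diag1 ` H. ?a g ` S = S" using inv_iff by simp
    moreover have "S \<noteq> standard_system"
      using xy line_neq_infinity by (auto simp: standard_system_eq doubleton_eq_iff)
    ultimately show ?A
      unfolding additional_system_def sys
      using xy(1) is_line_line[of x] is_line_line[of y] is_direct_sum_lines[OF xy(2)] by auto
  qed
qed

section \<open>Pairs of slopes invariant under the generators\<close>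

lemma complex_unit_Re_Im: "cmod z = 1 \<Longrightarrow> (Re z)\<^sup>2 + (Im z)\<^sup>2 = 1"
  using cmod_power2[of z] by simp

lemma quat_scaled_eq_iff:
  assumes "x \<noteq> 0"
  shows "quat_of_complex c * x = x \<longleftrightarrow> c = 1" "quat_of_complex c * x = - x \<longleftrightarrow> c = -1"
proof -
  have "quat_of_complex c * x = x \<longleftrightarrow> (quat_of_complex c - 1) * x = 0"
    "quat_of_complex c * x = - x \<longleftrightarrow> (quat_of_complex c + 1) * x = 0"
    by (simp_all only: left_diff_distrib distrib_right mult_1_left right_minus_eq eq_neg_iff_add_eq_0)
  then show "quat_of_complex c * x = x \<longleftrightarrow> c = 1" "quat_of_complex c * x = - x \<longleftrightarrow> c = -1"
    using assms by (simp_all add: eq_iff_diff_eq_0[of _ 1, symmetric] add_eq_0_iff2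
        quat_of_complex_eq_1_iff quat_of_complex_eq_m1_iff)
qed

lemma cnj_eq_units: "cnj z = 1 \<longleftrightarrow> z = 1" "cnj z = -1 \<longleftrightarrow> z = -1"
  by (auto simp: complex_eq_iff)

text \<open>The substance of the tests below: the products \<open>qcnj \<beta> * x * qcnj \<beta>\<close> for the candidate
  slopes \<open>x\<close> of absolute value one. A complex \<open>\<beta>\<close> commutes with \<open>i\<close> and is conjugated by passing
  it across \<open>j\<close> or \<open>k\<close>, so that its two occurrences either combine to a square or cancel.\<close>

lemma sandwich_complex:
  "qcnj (quat_of_complex z) * 1 * qcnj (quat_of_complex z) = quat_of_complex (cnj (z\<^sup>2)) * 1"
  "qcnj (quat_of_complex z) * qi * qcnj (quat_of_complex z) = quat_of_complex (cnj (z\<^sup>2)) * qi"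
  "cmod z = 1 \<Longrightarrow> qcnj (quat_of_complex z) * qj * qcnj (quat_of_complex z) = qj"
  "cmod z = 1 \<Longrightarrow> qcnj (quat_of_complex z) * qk * qcnj (quat_of_complex z) = qk"
  using complex_unit_Re_Im[of z]
  by (simp_all add: quat_calc) (simp_all add: power2_eq_square algebra_simps)

lemma sandwich_complex_j:
  "cmod w = 1 \<Longrightarrow> qcnj (quat_of_complex w * qj) * 1 * qcnj (quat_of_complex w * qj) = - 1"
  "cmod w = 1 \<Longrightarrow> qcnj (quat_of_complex w * qj) * qi * qcnj (quat_of_complex w * qj) = qi"
  "qcnj (quat_of_complex w * qj) * qj * qcnj (quat_of_complex w * qj) = quat_of_complex (- (w\<^sup>2)) * qj"
  "qcnj (quat_of_complex w * qj) * qk * qcnj (quat_of_complex w * qj) = quat_of_complex (w\<^sup>2) * qk"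
  using complex_unit_Re_Im[of w]
  by (simp_all add: quat_calc) (simp_all add: power2_eq_square algebra_simps)

lemma quat_units_inverse:
  "inverse (1::quat) = 1" "inverse qi = - qi" "inverse qj = - qj" "inverse qk = - qk"
  by (simp_all add: quat_calc)

lemma quat_units_nonzero: "qi \<noteq> 0" "qj \<noteq> 0" "qk \<noteq> 0"
  by (simp_all add: quat_calc)

text \<open>If inversion maps \<open>x\<close> to \<open>x\<close> or to \<open>- x\<close>, the inverse in \<open>antidiag_slope\<close> can be dropped on
  the pair \<open>{x, - x}\<close>: the map is odd, so it suffices to look at one element up to sign.\<close>

lemma antidiag_slope_opposite_pair:
  assumes "inverse x = x \<or> inverse x = - x"
  shows "antidiag_slope \<beta> ` {x, - x} = {x, - x} \<longleftrightarrow>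
    qcnj \<beta> * x * qcnj \<beta> = x \<or> qcnj \<beta> * x * qcnj \<beta> = - x"
proof -
  have "antidiag_slope \<beta> ` {x, - x} = {qcnj \<beta> * x * qcnj \<beta>, - (qcnj \<beta> * x * qcnj \<beta>)}"
    using assms by (auto simp: antidiag_slope_def)
  then show ?thesis by (auto simp: doubleton_eq_iff)
qed

lemma scale_opposite_pair:
  assumes "x \<noteq> 0"
  shows "(\<lambda>x. x * qcnj h) ` {x, - x} = {x, - x} \<longleftrightarrow> h = 1 \<or> h = - 1"
proof -
  have "x * qcnj h = x \<longleftrightarrow> h = 1"
  proof -
    have "x * qcnj h = x * 1 \<longleftrightarrow> qcnj h = 1" using assms by (simp only: mult_cancel_left) simp
    then show ?thesis by (simp add: quat_calc)
  qed
  moreover have "x * qcnj h = - x \<longleftrightarrow> h = - 1"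
  proof -
    have "x * qcnj h = x * (- 1) \<longleftrightarrow> qcnj h = - 1" using assms by (simp only: mult_cancel_left) simp
    then show ?thesis by (simp add: quat_calc)
  qed
  ultimately show ?thesis by (auto simp: doubleton_eq_iff)
qed

lemma opposite_pair_complex:
  assumes "cmod z = 1"
  shows "antidiag_slope (quat_of_complex z) ` {1, - 1} = {1, - 1} \<longleftrightarrow> z\<^sup>2 = 1 \<or> z\<^sup>2 = -1"
    "antidiag_slope (quat_of_complex z) ` {qi, - qi} = {qi, - qi} \<longleftrightarrow> z\<^sup>2 = 1 \<or> z\<^sup>2 = -1"
    "antidiag_slope (quat_of_complex z) ` {qj, - qj} = {qj, - qj}"
    "antidiag_slope (quat_of_complex z) ` {qk, - qk} = {qk, - qk}"
  using assms
  by (simp_all only: antidiag_slope_opposite_pair quat_units_inverse sandwich_complex quat_scaled_eq_iff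
      quat_units_nonzero one_neq_zero not_False_eq_True cnj_eq_units simp_thms)

lemma opposite_pair_complex_j:
  assumes "cmod w = 1"
  shows "antidiag_slope (quat_of_complex w * qj) ` {1, - 1} = {1, - 1}"
    "antidiag_slope (quat_of_complex w * qj) ` {qi, - qi} = {qi, - qi}"
    "antidiag_slope (quat_of_complex w * qj) ` {qj, - qj} = {qj, - qj} \<longleftrightarrow> w\<^sup>2 = 1 \<or> w\<^sup>2 = -1"
    "antidiag_slope (quat_of_complex w * qj) ` {qk, - qk} = {qk, - qk} \<longleftrightarrow> w\<^sup>2 = 1 \<or> w\<^sup>2 = -1"
proof -
  have "- (w\<^sup>2) = 1 \<longleftrightarrow> w\<^sup>2 = - 1" "- (w\<^sup>2) = - 1 \<longleftrightarrow> w\<^sup>2 = 1"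
    by (auto simp: minus_equation_iff[of "w\<^sup>2"])
  then show "antidiag_slope (quat_of_complex w * qj) ` {1, - 1} = {1, - 1}"
    "antidiag_slope (quat_of_complex w * qj) ` {qi, - qi} = {qi, - qi}"
    "antidiag_slope (quat_of_complex w * qj) ` {qj, - qj} = {qj, - qj} \<longleftrightarrow> w\<^sup>2 = 1 \<or> w\<^sup>2 = -1"
    "antidiag_slope (quat_of_complex w * qj) ` {qk, - qk} = {qk, - qk} \<longleftrightarrow> w\<^sup>2 = 1 \<or> w\<^sup>2 = -1"
    using assms
    by (simp_all only: antidiag_slope_opposite_pair quat_units_inverse sandwich_complex_j
        quat_scaled_eq_iff quat_units_nonzero not_False_eq_True simp_thms disj_commute)
qed

lemma inverse_scaled_k:
  assumes "\<alpha> \<noteq> 0"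
  shows "inverse (\<alpha> *\<^sub>R qk) = (- inverse \<alpha>) *\<^sub>R qk"
  using assms by (simp add: inverse_scaleR_distrib quat_units_inverse)

lemma antidiag_slope_scaled_k_complex:
  assumes "cmod z = 1" "\<alpha> \<noteq> 0"
  shows "antidiag_slope (quat_of_complex z) (\<alpha> *\<^sub>R qk) = (- inverse \<alpha>) *\<^sub>R qk"
  unfolding antidiag_slope_def inverse_scaled_k[OF assms(2)]
  using sandwich_complex(4)[OF assms(1)] by simp

lemma antidiag_slope_scaled_k_complex_j:
  assumes "\<alpha> \<noteq> 0"
  shows "antidiag_slope (quat_of_complex w * qj) (\<alpha> *\<^sub>R qk) = quat_of_complex (w\<^sup>2) * ((- inverse \<alpha>) *\<^sub>R qk)"
  unfolding antidiag_slope_def inverse_scaled_k[OF assms]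
  using sandwich_complex_j(4)[of w] by simp

lemma scaled_k_pair_complex:
  assumes "cmod z = 1" "\<alpha> \<noteq> 0"
  shows "antidiag_slope (quat_of_complex z) ` {\<alpha> *\<^sub>R qk, (- inverse \<alpha>) *\<^sub>R qk}
    = {\<alpha> *\<^sub>R qk, (- inverse \<alpha>) *\<^sub>R qk}"
  using antidiag_slope_scaled_k_complex[OF assms(1), of \<alpha>] antidiag_slope_scaled_k_complex[OF assms(1), of "- inverse \<alpha>"] assms(2)
  by (simp add: insert_commute)

text \<open>The two slopes \<open>\<alpha> k\<close> and \<open>- inverse \<alpha> k\<close> have different absolute values when
  \<open>\<bar>\<alpha>\<bar> < 1\<close>, so multiplication by a unit cannot carry one to the other.\<close>

lemma unit_quat_scale_k_neq:
  assumes "g * qcnj g = 1" "\<alpha> \<noteq> 0" "\<bar>\<alpha>\<bar> < 1"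
  shows "g * (\<alpha> *\<^sub>R qk) \<noteq> (- inverse \<alpha>) *\<^sub>R qk" "(\<alpha> *\<^sub>R qk) * g \<noteq> (- inverse \<alpha>) *\<^sub>R qk"
proof -
  have False if "\<alpha> * qRe g = - inverse \<alpha>" "qIm1 g = 0" "qIm2 g = 0" "qIm3 g = 0"
  proof -
    have "(qRe g)\<^sup>2 = 1" using assms(1) that by (simp add: unit_quat_norm)
    then have "\<bar>qRe g\<bar> = 1" by (auto simp: power2_eq_1_iff)
    then have "\<bar>\<alpha>\<bar> = \<bar>\<alpha> * qRe g\<bar>" by (simp add: abs_mult)
    also have "\<dots> = inverse \<bar>\<alpha>\<bar>" using that(1) by simp
    also have "\<dots> > 1" using assms by (simp add: one_less_inverse_iff)
    finally show False using assms by simp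
  qed
  then show "g * (\<alpha> *\<^sub>R qk) \<noteq> (- inverse \<alpha>) *\<^sub>R qk" "(\<alpha> *\<^sub>R qk) * g \<noteq> (- inverse \<alpha>) *\<^sub>R qk"
    using assms(2) by (auto simp add: quat_calc mult.commute)
qed

lemma scaled_k_pair_complex_j:
  assumes "cmod w = 1" "\<alpha> \<noteq> 0" "\<bar>\<alpha>\<bar> < 1"
  shows "antidiag_slope (quat_of_complex w * qj) ` {\<alpha> *\<^sub>R qk, (- inverse \<alpha>) *\<^sub>R qk}
    = {\<alpha> *\<^sub>R qk, (- inverse \<alpha>) *\<^sub>R qk} \<longleftrightarrow> w\<^sup>2 = 1"
proof -
  let ?x = "\<alpha> *\<^sub>R qk" and ?y = "(- inverse \<alpha>) *\<^sub>R qk"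
  have nz: "?x \<noteq> 0" "?y \<noteq> 0" using assms by (simp_all add: quat_units_nonzero)
  have im: "antidiag_slope (quat_of_complex w * qj) ?x = quat_of_complex (w\<^sup>2) * ?y"
    "antidiag_slope (quat_of_complex w * qj) ?y = quat_of_complex (w\<^sup>2) * ?x"
    using antidiag_slope_scaled_k_complex_j[of \<alpha> w] antidiag_slope_scaled_k_complex_j[of "- inverse \<alpha>" w] assms(2)
    by simp_all
  have "quat_of_complex (w\<^sup>2) * ?x \<noteq> ?y"
    using unit_quat_complex[of "w\<^sup>2"] assms by (intro unit_quat_scale_k_neq) (simp_all add: norm_power)
  then show ?thesis
    unfolding image_insert image_empty im doubleton_eq_iff quat_scaled_eq_iff(1)[OF nz(1)] quat_scaled_eq_iff(1)[OF nz(2)]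
    by blast
qed

lemma scale_scaled_k_pair:
  assumes "h * qcnj h = 1" "\<alpha> \<noteq> 0" "\<bar>\<alpha>\<bar> < 1"
  shows "(\<lambda>x. x * qcnj h) ` {\<alpha> *\<^sub>R qk, (- inverse \<alpha>) *\<^sub>R qk}
    = {\<alpha> *\<^sub>R qk, (- inverse \<alpha>) *\<^sub>R qk} \<longleftrightarrow> h = 1"
proof -
  let ?x = "\<alpha> *\<^sub>R qk" and ?y = "(- inverse \<alpha>) *\<^sub>R qk"
  have "qcnj h * qcnj (qcnj h) = 1"
    using assms(1) unit_quat_commute[of h] by (simp add: qcnj_def)
  then have "?x * qcnj h \<noteq> ?y" using assms by (intro unit_quat_scale_k_neq)
  moreover have "?x * qcnj h = ?x \<longleftrightarrow> h = 1" "h = 1 \<Longrightarrow> ?y * qcnj h = ?y"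
    using assms(2) by (auto simp: quat_calc)
  ultimately show ?thesis
    unfolding image_insert image_empty doubleton_eq_iff by blast
qed

text \<open>Each of the three generators permutes the two slopes, so it either fixes or exchanges them,
  and each alternative is an equation for the slopes. Exchanging under \<open>\<beta> = j\<close> is linear in
  \<open>y\<close> and cuts out the span of \<open>i\<close> and \<open>k\<close>; fixing makes \<open>j y\<close> a square root of \<open>1\<close>.
  On that span, with \<open>z = u + v i\<close> and \<open>v \<noteq> 0\<close>, exchanging under \<open>z\<close> removes the \<open>i\<close>-component,
  while fixing is only possible for \<open>y = \<plusminus>i\<close>. The pair \<open>{k, - k}\<close> is the case \<open>\<alpha> = \<plusminus>1\<close> of the
  last alternative; as \<open>\<alpha>\<close> and \<open>- inverse \<alpha>\<close> give the same pair, \<open>\<bar>\<alpha>\<bar> \<le> 1\<close> can be achieved.\<close>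

lemma invariant_pair_cases:
  assumes nz: "x \<noteq> 0" "y \<noteq> 0" "x \<noteq> y" and z: "cmod z = 1" "z\<^sup>2 \<noteq> 1"
    and inv_1: "antidiag_slope 1 ` {x, y} = {x, y}"
    and inv_j: "antidiag_slope qj ` {x, y} = {x, y}"
    and inv_z: "antidiag_slope (quat_of_complex z) ` {x, y} = {x, y}"
  shows "{x, y} = {1, - 1} \<or> {x, y} = {qi, - qi} \<or> {x, y} = {qj, - qj} \<or>
    (\<exists>\<alpha>. \<alpha> \<noteq> 0 \<and> \<bar>\<alpha>\<bar> \<le> 1 \<and> {x, y} = {\<alpha> *\<^sub>R qk, (- inverse \<alpha>) *\<^sub>R qk})"
proof -
  have "(inverse x = x \<and> inverse y = y) \<or> (inverse x = y \<and> inverse y = x)"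
    using inv_1 by (simp add: antidiag_slope_def doubleton_eq_iff quat_calc)
  then show ?thesis
  proof
    assume "inverse x = x \<and> inverse y = y"
    then have "x * x = 1" "y * y = 1" using nz by (metis right_inverse)+
    then have "x = 1 \<or> x = - 1" "y = 1 \<or> y = - 1" by (simp_all only: square_eq_1_iff)
    with nz show ?thesis by auto
  next
    assume inv: "inverse x = y \<and> inverse y = x"
    then have yx: "x * y = 1" using nz by auto
    have cj: "qcnj qj = - qj" by (simp add: quat_calc)
    consider "qcnj qj * y * qcnj qj = x" | "qcnj qj * y * qcnj qj = y"
      using inv_j inv by (auto simp: antidiag_slope_def doubleton_eq_iff)
    then show ?thesis
    proof cases
      case 1
      then have "qj * y * qj = x" by (simp add: cj)
      then have "(qj * y) * (qj * y) = 1" using yx by (simp only: mult.assoc[symmetric])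
      then have "qj * y = 1 \<or> qj * y = - 1" by (simp only: square_eq_1_iff)
      then have "y = - qj \<or> y = qj" by (auto simp: quat_calc)
      moreover have "x = - y" using calculation inv by (auto simp: quat_units_inverse)
      ultimately show ?thesis by auto
    next
      case 2
      then have ik: "qRe y = 0" "qIm2 y = 0" by (simp_all add: quat_calc)
      define u v p q where "u = Re z" and "v = Im z" and "p = qIm1 y" and "q = qIm3 y"
      have uv: "u * u + v * v = 1" using complex_unit_Re_Im[OF z(1)] by (simp add: u_def v_def power2_eq_square)
      have "v \<noteq> 0"
      proof
        assume "v = 0"
        then have "z\<^sup>2 = 1" using uv by (simp add: complex_eq_iff power2_eq_square u_def v_def)
        with z show False by blast
      qed
      have y: "y = Quat 0 p 0 q" by (simp add: quat_eq_iff ik p_def q_def)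
      have zz: "quat_of_complex z = Quat u v 0 0" by (simp add: quat_of_complex_def u_def v_def)
      let ?s = "qcnj (quat_of_complex z) * y * qcnj (quat_of_complex z)"
      consider "?s = x" | "?s = y"
        using inv_z inv by (auto simp: antidiag_slope_def doubleton_eq_iff)
      then show ?thesis
      proof cases
        case 1
        then have "?s * y = 1" using yx by simp
        moreover have "qRe (?s * y) = - (p * p) * (u * u - v * v) - q * q * (u * u + v * v)"
          "qIm1 (?s * y) = 2 * u * v * (p * p)"
          "qIm2 (?s * y) = p * q * (u * u + v * v) - p * q * (u * u - v * v)"
          unfolding zz y by (simp_all add: quat_calc algebra_simps)
        ultimately have re: "- (p * p) * (u * u - v * v) - q * q = 1"
          and im: "2 * u * v * (p * p) = 0" and jm: "p * q * (1 - (u * u - v * v)) = 0"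
          by (simp_all add: uv quat_defs algebra_simps)
        have "p \<noteq> 0"
        proof
          assume "p = 0"
          then have "- (q * q) = 1" using re by simp
          then show False using zero_le_square[of q] by linarith
        qed
        then have "u = 0" using im \<open>v \<noteq> 0\<close> by simp
        then have "v * v = 1" using uv by simp
        then have "q = 0" using jm \<open>p \<noteq> 0\<close> \<open>u = 0\<close> by simp
        then have "p * p = 1" using re \<open>u = 0\<close> \<open>v * v = 1\<close> by simp
        then have "p = 1 \<or> p = - 1" by (simp only: square_eq_1_iff)
        then have "y = qi \<or> y = - qi" using \<open>q = 0\<close> by (auto simp: y quat_calc)
        moreover have "x = - y" using calculation inv by (auto simp: quat_units_inverse)
        ultimately show ?thesis by auto
      next
        case 2
        then have "qIm1 ?s = p" by (simp add: y)
        then have "p * (u * u - v * v) = p"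
          unfolding zz y by (simp add: quat_calc algebra_simps)
        moreover have "u * u = 1 - v * v" using uv by linarith
        ultimately have "p * (1 - v * v - v * v) = p" by simp
        then have "p * (2 * (v * v)) = 0" by (simp add: right_diff_distrib)
        then have "p = 0" using \<open>v \<noteq> 0\<close> by simp
        then have yk: "y = q *\<^sub>R qk" by (simp add: y quat_calc)
        then have "q \<noteq> 0" using nz(2) by (metis scaleR_zero_left)
        have xk: "x = (- inverse q) *\<^sub>R qk"
          using inv yk inverse_scaled_k[OF \<open>q \<noteq> 0\<close>] by metis
        show ?thesis
        proof (cases "\<bar>q\<bar> \<le> 1")
          case True
          then show ?thesis using xk yk \<open>q \<noteq> 0\<close> by blast
        next
          case False
          then have "\<bar>- inverse q\<bar> \<le> 1" by (simp add: inverse_le_1_iff)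
          moreover have "y = (- inverse (- inverse q)) *\<^sub>R qk" using yk \<open>q \<noteq> 0\<close> by simp
          ultimately show ?thesis using xk \<open>q \<noteq> 0\<close>
            by (intro disjI2 exI[of _ "- inverse q"]) simp
        qed
      qed
    qed
  qed
qed

section \<open>Additional systems for complex parameters\<close>

lemma system_given_by_units:
  "system_given_by 1 = {line 1, line (- 1)}"
  "system_given_by qi = {line qi, line (- qi)}"
  "system_given_by qj = {line qj, line (- qj)}"
  "system_given_by qk = {line qk, line (- qk)}"
proof -
  have "qcnj 1 = 1" "qcnj qi = - qi" "qcnj qj = - qj" "qcnj qk = - qk"
    by (simp_all add: quat_calc)
  then show "system_given_by 1 = {line 1, line (- 1)}"
    "system_given_by qi = {line qi, line (- qi)}"
    "system_given_by qj = {line qj, line (- qj)}"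
    "system_given_by qk = {line qk, line (- qk)}"
    by (simp_all add: system_given_by_eq quat_units_nonzero quat_units_inverse)
qed

lemma system_given_by_scaled_k:
  assumes "\<alpha> \<noteq> 0"
  shows "system_given_by (\<alpha> *\<^sub>R qk) = {line (\<alpha> *\<^sub>R qk), line ((- inverse \<alpha>) *\<^sub>R qk)}"
proof -
  have "- qcnj (\<alpha> *\<^sub>R qk) = \<alpha> *\<^sub>R qk" by (simp add: quat_calc)
  then show ?thesis
    using assms by (simp only: system_given_by_eq quat_units_nonzero scaleR_eq_0_iff
        inverse_scaled_k simp_thms not_False_eq_True)
qed

text \<open>This covers all groups for the dicyclic groups at once, with powers of \<open>\<omega>\<close> for \<open>z\<close> and \<open>w\<close>.
  The forward direction splits off \<open>\<alpha> = \<plusminus>1\<close> from the last family of candidates: there, and only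
  there, multiplication by \<open>- 1\<close> exchanges the two slopes, which relaxes the conditions on \<open>w\<^sup>2\<close> and \<open>H\<close>.\<close>

lemma additional_system_complex_j_iff:
  assumes z: "cmod z = 1" "z\<^sup>2 \<noteq> 1" and w: "cmod w = 1"
    and H: "\<And>h. h \<in> H \<Longrightarrow> h * qcnj h = 1"
  shows "additional_system
      (group_LH {1, quat_of_complex z, qj, quat_of_complex w * qj} H) S \<longleftrightarrow>
    (S = system_given_by 1 \<or> S = system_given_by qi) \<and> z\<^sup>2 = - 1 \<and> H \<subseteq> {1, - 1} \<or>
    (S = system_given_by qj \<or> S = system_given_by qk) \<and> (w\<^sup>2 = 1 \<or> w\<^sup>2 = - 1) \<and> H \<subseteq> {1, - 1} \<or>
    (\<exists>\<alpha>. \<alpha> \<noteq> 0 \<and> \<bar>\<alpha>\<bar> < 1 \<and> S = system_given_by (\<alpha> *\<^sub>R qk)) \<and> w\<^sup>2 = 1 \<and> H \<subseteq> {1}"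
    (is "?A \<longleftrightarrow> ?B")
proof -
  let ?L = "{1, quat_of_complex z, qj, quat_of_complex w * qj}"
  define stable where "stable P \<longleftrightarrow> (\<forall>\<beta>\<in>?L. antidiag_slope \<beta> ` P = P) \<and> (\<forall>h\<in>H. (\<lambda>x. x * qcnj h) ` P = P)" for P
  have L: "\<beta> * qcnj \<beta> = 1" if "\<beta> \<in> ?L" for \<beta>
    using that z(1) w unit_quat_units unit_quat_complex unit_quat_mult by blast
  have add: "?A \<longleftrightarrow> (\<exists>x y. S = {line x, line y} \<and> x \<noteq> y \<and> x \<noteq> 0 \<and> y \<noteq> 0 \<and> stable {x, y})"
    unfolding stable_def by (rule additional_system_iff) (use L H in auto)
  note one = quat_of_complex_one
  have c1: "cmod 1 = 1" by simp
  note at1 = opposite_pair_complex[OF c1, unfolded one] opposite_pair_complex_j[OF c1, unfolded one mult_1_left]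
  have inv_1: "stable {1, - 1} \<longleftrightarrow> z\<^sup>2 = - 1 \<and> H \<subseteq> {1, - 1}"
    using z(2) by (auto simp: stable_def at1 opposite_pair_complex[OF z(1)] opposite_pair_complex_j[OF w]
        scale_opposite_pair quat_units_nonzero simp del: image_insert)
  have inv_i: "stable {qi, - qi} \<longleftrightarrow> z\<^sup>2 = - 1 \<and> H \<subseteq> {1, - 1}"
    using z(2) by (auto simp: stable_def at1 opposite_pair_complex[OF z(1)] opposite_pair_complex_j[OF w]
        scale_opposite_pair quat_units_nonzero simp del: image_insert)
  have inv_jk: "stable {qj, - qj} \<longleftrightarrow> (w\<^sup>2 = 1 \<or> w\<^sup>2 = - 1) \<and> H \<subseteq> {1, - 1}"
    "stable {qk, - qk} \<longleftrightarrow> (w\<^sup>2 = 1 \<or> w\<^sup>2 = - 1) \<and> H \<subseteq> {1, - 1}"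
    by (auto simp: stable_def at1 opposite_pair_complex[OF z(1)] opposite_pair_complex_j[OF w]
        scale_opposite_pair quat_units_nonzero simp del: image_insert)
  have inv_ak: "stable {\<alpha> *\<^sub>R qk, (- inverse \<alpha>) *\<^sub>R qk} \<longleftrightarrow> w\<^sup>2 = 1 \<and> H \<subseteq> {1}"
    if "\<alpha> \<noteq> 0" "\<bar>\<alpha>\<bar> < 1" for \<alpha>
  proof -
    have "(\<forall>h\<in>H. (\<lambda>x. x * qcnj h) ` {\<alpha> *\<^sub>R qk, (- inverse \<alpha>) *\<^sub>R qk}
        = {\<alpha> *\<^sub>R qk, (- inverse \<alpha>) *\<^sub>R qk}) \<longleftrightarrow> H \<subseteq> {1}"
      using scale_scaled_k_pair[OF H that] by blast
    moreover have "antidiag_slope \<beta> ` {\<alpha> *\<^sub>R qk, (- inverse \<alpha>) *\<^sub>R qk}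
        = {\<alpha> *\<^sub>R qk, (- inverse \<alpha>) *\<^sub>R qk}" if "\<beta> \<in> {1, quat_of_complex z, qj}" for \<beta>
      using that scaled_k_pair_complex[OF c1 \<open>\<alpha> \<noteq> 0\<close>] scaled_k_pair_complex[OF z(1) \<open>\<alpha> \<noteq> 0\<close>]
        scaled_k_pair_complex_j[OF c1 \<open>\<alpha> \<noteq> 0\<close> \<open>\<bar>\<alpha>\<bar> < 1\<close>]
      unfolding one mult_1_left by auto
    ultimately show ?thesis
      unfolding stable_def ball_simps using scaled_k_pair_complex_j[OF w that] by simp
  qed
  show ?thesis
  proof
    assume ?A
    then obtain x y where S: "S = {line x, line y}" and xy: "x \<noteq> 0" "y \<noteq> 0" "x \<noteq> y"
      and inv: "stable {x, y}"
      unfolding add by blast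
    have lines: "S = {line a, line b}" if "{x, y} = {a, b}" for a b
      using that by (auto simp: S doubleton_eq_iff)
    have "{x, y} = {1, - 1} \<or> {x, y} = {qi, - qi} \<or> {x, y} = {qj, - qj} \<or>
        (\<exists>\<alpha>. \<alpha> \<noteq> 0 \<and> \<bar>\<alpha>\<bar> \<le> 1 \<and> {x, y} = {\<alpha> *\<^sub>R qk, (- inverse \<alpha>) *\<^sub>R qk})"
      using inv by (intro invariant_pair_cases[OF xy z]) (simp_all add: stable_def del: image_insert)
    then consider "{x, y} = {1, - 1}" | "{x, y} = {qi, - qi}" | "{x, y} = {qj, - qj}"
      | "{x, y} = {qk, - qk}"
      | \<alpha> where "\<alpha> \<noteq> 0" "\<bar>\<alpha>\<bar> < 1" "{x, y} = {\<alpha> *\<^sub>R qk, (- inverse \<alpha>) *\<^sub>R qk}"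
    proof (elim disjE exE)
      fix \<alpha> assume *: "\<alpha> \<noteq> 0 \<and> \<bar>\<alpha>\<bar> \<le> 1 \<and> {x, y} = {\<alpha> *\<^sub>R qk, (- inverse \<alpha>) *\<^sub>R qk}"
      then consider "\<alpha> = 1" | "\<alpha> = - 1" | "\<bar>\<alpha>\<bar> < 1" by linarith
      then show thesis
        using * that(4,5) by cases (auto simp: insert_commute)
    qed
    then show ?B
    proof cases
      case 1 then show ?thesis using lines inv inv_1 system_given_by_units(1) by metis
    next
      case 2 then show ?thesis using lines inv inv_i system_given_by_units(2) by metis
    next
      case 3 then show ?thesis using lines inv inv_jk(1) system_given_by_units(3) by metis
    next
      case 4 then show ?thesis using lines inv inv_jk(2) system_given_by_units(4) by metis
    next
      case 5 then show ?thesis using lines inv inv_ak system_given_by_scaled_k by metis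
    qed
  next
    have opp: "x \<noteq> - x" if "x \<noteq> 0" for x :: quat
      using that by (simp add: quat_calc)
    have addI: ?A if "S = {line x, line y}" "x \<noteq> y" "x \<noteq> 0" "y \<noteq> 0" "stable {x, y}" for x y
      using that unfolding add by blast
    assume ?B
    then show ?A
    proof (elim disjE conjE exE)
      assume "S = system_given_by 1" "z\<^sup>2 = - 1" "H \<subseteq> {1, - 1}"
      then show ?A using inv_1 system_given_by_units(1) by (intro addI[of 1 "- 1"]) (auto simp: opp)
    next
      assume "S = system_given_by qi" "z\<^sup>2 = - 1" "H \<subseteq> {1, - 1}"
      then show ?A using inv_i system_given_by_units(2) quat_units_nonzero
        by (intro addI[of qi "- qi"]) (auto simp: opp)
    next
      assume "S = system_given_by qj" "w\<^sup>2 = 1" "H \<subseteq> {1, - 1}"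
      then show ?A using inv_jk system_given_by_units(3) quat_units_nonzero
        by (intro addI[of qj "- qj"]) (auto simp: opp)
    next
      assume "S = system_given_by qj" "w\<^sup>2 = - 1" "H \<subseteq> {1, - 1}"
      then show ?A using inv_jk system_given_by_units(3) quat_units_nonzero
        by (intro addI[of qj "- qj"]) (auto simp: opp)
    next
      assume "S = system_given_by qk" "w\<^sup>2 = 1" "H \<subseteq> {1, - 1}"
      then show ?A using inv_jk system_given_by_units(4) quat_units_nonzero
        by (intro addI[of qk "- qk"]) (auto simp: opp)
    next
      assume "S = system_given_by qk" "w\<^sup>2 = - 1" "H \<subseteq> {1, - 1}"
      then show ?A using inv_jk system_given_by_units(4) quat_units_nonzero
        by (intro addI[of qk "- qk"]) (auto simp: opp)
    next
      fix \<alpha> assume S: "w\<^sup>2 = 1" "H \<subseteq> {1}" "\<alpha> \<noteq> 0" "\<bar>\<alpha>\<bar> < 1" "S = system_given_by (\<alpha> *\<^sub>R qk)"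
      have "\<alpha> \<noteq> - inverse \<alpha>"
      proof
        assume "\<alpha> = - inverse \<alpha>"
        then have "\<alpha> * \<alpha> = - 1" using S(3) by (metis mult_minus_right right_inverse)
        then show False using zero_le_square[of \<alpha>] by linarith
      qed
      then have "\<alpha> *\<^sub>R qk \<noteq> (- inverse \<alpha>) *\<^sub>R qk"
        using quat_units_nonzero by (simp only: scaleR_cancel_right simp_thms)
      then show ?A using S inv_ak[OF S(3,4)] system_given_by_scaled_k[OF S(3)] quat_units_nonzero
        by (intro addI[of "\<alpha> *\<^sub>R qk" "(- inverse \<alpha>) *\<^sub>R qk"]) auto
    qed
  qed
qed

section \<open>Powers of the root of unity\<close>

lemma omega_power: "omega n ^ m = quat_of_complex (cis (pi * m / n))"
proof -
  have "omega n = quat_of_complex (cis (pi / n))"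
    by (simp add: omega_def cis_conv_exp mult.commute)
  then show ?thesis
    by (simp add: quat_of_complex_power Complex.DeMoivre mult.commute)
qed

lemma omega_power_eq_1_iff:
  assumes "n \<ge> 1"
  shows "omega n ^ m = 1 \<longleftrightarrow> 2 * n dvd m"
proof
  assume "omega n ^ m = 1"
  then have "cis (pi * m / n) = 1" by (simp add: omega_power quat_of_complex_eq_1_iff)
  then have "cos (pi * m / n) = 1" by (metis cis.sel(1) one_complex.sel(1))
  then obtain k :: int where "pi * m / n = of_int k * 2 * pi"
    by (auto simp: cos_one_2pi_int)
  then have "real_of_int (int m) = real_of_int (2 * int n * k)" using assms by (simp add: field_simps)
  then have "int m = int (2 * n) * k" by (simp only: of_int_eq_iff)
  then have "int (2 * n) dvd int m" by (rule dvdI)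
  then show "2 * n dvd m" by (simp only: int_dvd_int_iff)
next
  assume "2 * n dvd m"
  then obtain k where "m = 2 * n * k" by (rule dvdE)
  then have "pi * m / n = 2 * pi * k" using assms by (simp add: field_simps)
  then show "omega n ^ m = 1"
    by (simp add: omega_power quat_of_complex_eq_1_iff)
qed

text \<open>Reduced to the preceding lemma by \<open>\<omega>\<^sup>n = - 1\<close>.\<close>

lemma omega_power_eq_m1_iff:
  assumes "n \<ge> 1"
  shows "omega n ^ m = - 1 \<longleftrightarrow> 2 * n dvd m + n"
proof -
  have "omega n ^ n = - 1"
    using assms by (simp add: omega_power quat_of_complex_eq_m1_iff)
  then have "omega n ^ (m + n) = - (omega n ^ m)" by (simp add: power_add)
  then show ?thesis
    using omega_power_eq_1_iff[OF assms, of "m + n"] by (metis minus_minus)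
qed

text \<open>The exponents are small compared with the order \<open>2n\<close>: as \<open>2a + n\<close> lies strictly between
  \<open>0\<close> and \<open>4n\<close>, it can only be the multiple \<open>2n\<close> itself.\<close>

lemma omega_square_iff:
  assumes "1 \<le> a" "a \<le> n"
  shows "omega n ^ (2 * a) = 1 \<longleftrightarrow> a = n" "omega n ^ (2 * a) = - 1 \<longleftrightarrow> 2 * a = n"
proof -
  have n: "n \<ge> 1" using assms by simp
  have "n dvd a \<longleftrightarrow> a = n" using assms by (auto dest: dvd_imp_le)
  then show "omega n ^ (2 * a) = 1 \<longleftrightarrow> a = n"
    by (simp add: omega_power_eq_1_iff[OF n])
  have "2 * n dvd 2 * a + n \<longleftrightarrow> 2 * a = n"
  proof
    assume "2 * n dvd 2 * a + n"
    then obtain k where k: "2 * a + n = 2 * n * k" by (rule dvdE)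
    then have "n * 0 < n * (2 * k)" "n * (2 * k) \<le> n * 3" using assms by linarith+
    then have "0 < k" "2 * k \<le> 3" by simp_all
    then have "k = 1" by linarith
    with k show "2 * a = n" by simp
  next
    assume "2 * a = n"
    then have "2 * a + n = 2 * n" by simp
    then show "2 * n dvd 2 * a + n" by (metis dvd_refl)
  qed
  then show "omega n ^ (2 * a) = - 1 \<longleftrightarrow> 2 * a = n"
    by (simp add: omega_power_eq_m1_iff[OF n])
qed

lemma omega_root_iff:
  assumes "n \<ge> 1" "r dvd 2 * n"
  shows "omega n ^ (2 * n div r) = 1 \<longleftrightarrow> r = 1" "omega n ^ (2 * n div r) = - 1 \<longleftrightarrow> r = 2"
proof -
  obtain m where m: "2 * n = r * m" using assms(2) by (rule dvdE)
  have "r > 0" "m > 0" using m assms(1) by (auto intro!: Nat.gr0I)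
  then have d: "2 * n div r = m" using m by simp
  have "2 * n dvd m \<longleftrightarrow> r = 1"
    using m \<open>m > 0\<close> \<open>r > 0\<close> by (metis dvd_refl dvd_times_right_cancel_iff less_not_refl mult_1 nat_dvd_1_iff_1)
  then show "omega n ^ (2 * n div r) = 1 \<longleftrightarrow> r = 1"
    by (simp add: d omega_power_eq_1_iff[OF assms(1)])
  have "2 * n dvd m + n \<longleftrightarrow> r = 2"
  proof
    assume "2 * n dvd m + n"
    then obtain k where k: "m + n = 2 * n * k" by (rule dvdE)
    have "m \<le> 2 * n" using m \<open>r > 0\<close> by simp
    then have "n * 0 < n * (2 * k)" "n * (2 * k) \<le> n * 3" using k assms(1) by linarith+
    then have "0 < k" "2 * k \<le> 3" using assms(1) by simp_all
    then have "k = 1" by linarith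
    then have "m = n" using k by simp
    with m assms(1) show "r = 2" by simp
  next
    assume "r = 2"
    then have "m + n = 2 * n" using m by simp
    then show "2 * n dvd m + n" by (metis dvd_refl)
  qed
  then show "omega n ^ (2 * n div r) = - 1 \<longleftrightarrow> r = 2"
    by (simp add: d omega_power_eq_m1_iff[OF assms(1)])
qed

section \<open>Conjugacy to the complex reflection group\<close>

text \<open>Let \<open>d\<close> be the diagonal matrix with entries \<open>-i\<close>, \<open>i\<close>. Both \<open>u = d ** antidiag qj\<close> and
  \<open>u' = d ** diag1 (- 1)\<close> have square \<open>-1\<close> and commute with \<open>d\<close> and with every \<open>antidiag z\<close>,
  \<open>z\<close> complex. Since \<open>(1 - u' u) u = u + u' = u' (1 - u' u)\<close>, the matrix \<open>1 - u' u\<close> conjugates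
  \<open>u\<close> to \<open>u'\<close> while centralizing \<open>d\<close> and these reflections, hence \<open>antidiag qj\<close> to
  \<open>diag1 (- 1)\<close>. This is the matrix below.\<close>

definition conjugator :: "quat^2^2" where
  "conjugator = vector [vector [1, - qj], vector [- qj, 1]]"

definition conjugator_inv :: "quat^2^2" where
  "conjugator_inv = vector [vector [(1/2) *\<^sub>R 1, (1/2) *\<^sub>R qj], vector [(1/2) *\<^sub>R qj, (1/2) *\<^sub>R 1]]"

lemmas matrix_calc = vec_eq_iff forall_2 matrix_matrix_mult_def sum_2 mat_def antidiag_def diag1_def

lemma conjugator_inverse: "conjugator ** conjugator_inv = mat 1" "conjugator_inv ** conjugator = mat 1"
  by (simp_all add: conjugator_def conjugator_inv_def matrix_calc) (simp_all add: quat_calc)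

lemma conjugator_centralizes:
  "conjugator ** antidiag (quat_of_complex z) = antidiag (quat_of_complex z) ** conjugator"
  by (simp add: conjugator_def matrix_calc) (simp add: quat_calc)

lemma conjugator_antidiag_j:
  "conjugator ** antidiag qj = diag1 (- 1) ** conjugator"
  by (simp add: conjugator_def matrix_calc) (simp add: quat_calc)

lemma antidiag_minus_j: "antidiag (- qj) = antidiag 1 ** antidiag qj ** antidiag 1"
  by (simp add: matrix_calc) (simp add: quat_calc)

lemma diag1_one: "diag1 1 = mat 1"
  by (simp add: matrix_calc)

text \<open>Of the generators of \<open>G(n, 1, n, 1)\<close>, those with complex entries are fixed by the conjugation,
  \<open>antidiag qj\<close> becomes \<open>diag1 (- 1)\<close>, and the last one, \<open>antidiag (- qj)\<close>, is conjugate to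
  \<open>antidiag qj\<close> under the swap and hence contributes nothing new. The diagonal generator is
  trivial because \<open>r = 1\<close>.\<close>

lemma G_nabr_conjugate_complex:
  assumes n: "n \<ge> 1"
  shows "conjugate_in_GL (G_nabr n 1 n 1) (G_complex n)"
proof -
  interpret group GL2H by (rule group_GL2H)
  have conjugator_carrier: "conjugator \<in> carrier GL2H" "conjugator_inv \<in> carrier GL2H"
    using conjugator_inverse by (auto simp: GL2H_def invertible_def)
  have inv_conjugator: "inv\<^bsub>GL2H\<^esub> conjugator = conjugator_inv"
    using conjugator_inverse conjugator_carrier by (intro inv_equality) (simp_all add: GL2H_def)
  define c where "c = (\<lambda>g. conjugator ** g ** conjugator_inv)"
  have cm: "c (A ** B) = c A ** c B" for A B
  proof -
    have "c A ** c B = conjugator ** A ** (conjugator_inv ** conjugator) ** B ** conjugator_inv"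
      by (simp only: c_def matrix_mul_assoc)
    then show ?thesis by (simp add: conjugator_inverse c_def matrix_mul_assoc)
  qed
  have c_eq: "c A = B" if "conjugator ** A = B ** conjugator" for A B
    unfolding c_def that by (simp add: conjugator_inverse flip: matrix_mul_assoc)
  have closed: "c A \<in> carrier GL2H" if "A \<in> carrier GL2H" for A
  proof -
    have "c A = conjugator \<otimes>\<^bsub>GL2H\<^esub> A \<otimes>\<^bsub>GL2H\<^esub> conjugator_inv" by (simp add: c_def GL2H_def)
    then show ?thesis using conjugator_carrier that by simp
  qed
  have "c \<in> hom GL2H GL2H"
    by (rule homI) (simp_all add: closed, simp add: cm GL2H_def)
  then interpret c: group_hom GL2H GL2H c by unfold_locales
  define s t d where "s = antidiag 1" and "t = antidiag (omega n)" and "d = diag1 (- 1)"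
  have om: "omega n = quat_of_complex (cis (pi / n))" using omega_power[of n 1] by simp
  have gens: "s \<in> carrier GL2H" "t \<in> carrier GL2H" "d \<in> carrier GL2H"
    using generators_in_GL2H unit_quat_units(1) unit_quat_complex[of "cis (pi / n)"]
    by (simp_all add: s_def t_def d_def om) (simp add: quat_calc)
  have jc: "antidiag qj \<in> carrier GL2H"
    using generators_in_GL2H unit_quat_units(3) by blast
  have om_n: "omega n ^ n = - 1" "omega n ^ (2 * n div 1) = 1"
    using n omega_power_eq_m1_iff[of n n] omega_power_eq_1_iff[of n "2 * n"] by (simp_all flip: mult_2)
  \<comment> \<open>Since \<open>\<omega>\<^sup>n = -1\<close>, the fourth generator is \<open>antidiag (- qj)\<close>. It is written as a product
    so that \<open>c\<close> can be evaluated on it.\<close>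
  let ?X = "{s, t, antidiag qj, s ** antidiag qj ** s, mat 1}"
  have "G_nabr n 1 n 1 = generate GL2H ?X"
    using om_n by (simp add: G_nabr_def group_LH_def s_def t_def antidiag_minus_j diag1_one insert_commute)
  moreover have XG: "?X \<subseteq> carrier GL2H"
    using gens jc m_closed[of "s \<otimes>\<^bsub>GL2H\<^esub> antidiag qj" s] m_closed[of s "antidiag qj"] one_closed
    by (simp add: GL2H_def)
  ultimately have img: "c ` G_nabr n 1 n 1 = generate GL2H (c ` ?X)"
    using c.generate_img[OF XG] by simp
  have cs: "c s = s" "c t = t" "c (antidiag qj) = d"
    using conjugator_centralizes[of 1] conjugator_centralizes[of "cis (pi / n)"] conjugator_antidiag_j
    by (auto intro!: c_eq simp: s_def t_def d_def om quat_of_complex_one)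
  have "c (mat 1) = mat 1" using c.hom_one by (simp add: GL2H_def)
  then have cX: "c ` ?X = {s, t, d, s ** d ** s, mat 1}"
    by (simp add: cm cs)
  have "generate GL2H {s, t, d, s ** d ** s, mat 1} = generate GL2H {s, t, d}"
  proof
    have sub: "subgroup (generate GL2H {s, t, d}) GL2H"
      using gens by (intro generate_is_subgroup) auto
    have in_gen: "s \<in> generate GL2H {s, t, d}" "t \<in> generate GL2H {s, t, d}" "d \<in> generate GL2H {s, t, d}"
      by (auto intro: generate.incl)
    have "s \<otimes>\<^bsub>GL2H\<^esub> d \<otimes>\<^bsub>GL2H\<^esub> s \<in> generate GL2H {s, t, d}"
      using in_gen by (intro generate.eng)
    moreover have "\<one>\<^bsub>GL2H\<^esub> \<in> generate GL2H {s, t, d}" by (rule generate.one)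
    ultimately have "{s, t, d, s ** d ** s, mat 1} \<subseteq> generate GL2H {s, t, d}"
      using in_gen by (simp add: GL2H_def)
    then show "generate GL2H {s, t, d, s ** d ** s, mat 1} \<subseteq> generate GL2H {s, t, d}"
      by (rule generate_subgroup_incl[OF _ sub])
  qed (rule mono_generate, auto)
  moreover have "G_complex n = generate GL2H {s, t, d}"
    by (simp add: G_complex_def group_LH_def s_def t_def d_def insert_commute)
  ultimately have "G_complex n = c ` G_nabr n 1 n 1"
    by (simp only: img cX)
  moreover have "c = (\<lambda>g. conjugator \<otimes>\<^bsub>GL2H\<^esub> g \<otimes>\<^bsub>GL2H\<^esub> inv\<^bsub>GL2H\<^esub> conjugator)"
    unfolding inv_conjugator by (simp add: c_def GL2H_def)
  ultimately show ?thesis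
    unfolding conjugate_in_GL_def using conjugator_carrier(1) by blast
qed

section \<open>The admissible indices\<close>

text \<open>Multiplying out the quotients in the index set makes the two possible values of \<open>r\<close>
  accessible to arithmetic.\<close>

lemma Lambda_setD:
  assumes "(m, a, b, r) \<in> Lambda_set n" "n \<ge> 1"
  shows "1 \<le> a" "a \<le> b" "b \<le> n" "a dvd n" "b dvd n" "coprime a b"
    and "r * (a * b) = n \<or> r * (a * b) = 2 * n \<and> odd (a * b)" and "r dvd 2 * n"
proof -
  have O: "(a, b) \<in> Omega_set n" "r = n div (a * b) \<or> r = 2 * n div (a * b) \<and> odd (a * b)"
    using assms(1) by (auto simp: Lambda_set_def)
  show "1 \<le> a" "a \<le> b" "b \<le> n" "a dvd n" "b dvd n" "coprime a b"
    using O(1) by (auto simp: Omega_set_def coprime_iff_gcd_eq_1)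
  have "a * b dvd n" "a * b dvd 2 * n" using Lambda_set_exact(1)[OF O(1)] by (simp_all only: dvd_mult)
  then show "r * (a * b) = n \<or> r * (a * b) = 2 * n \<and> odd (a * b)"
    using O(2) by (metis dvd_div_mult_self)
  then show "r dvd 2 * n" by (metis dvd_mult dvd_triv_left)
qed

lemma dvd_2_cases:
  fixes a :: nat
  assumes "a dvd 2"
  shows "a = 1 \<or> a = 2"
proof -
  have "a \<le> 2" "a \<noteq> 0" using assms dvd_imp_le[OF assms] by (auto intro!: Nat.gr0I)
  then show ?thesis by linarith
qed

text \<open>Coprimality drives all cases: \<open>b = n\<close> makes \<open>a\<close> a divisor of \<open>b\<close> and hence \<open>1\<close>, while
  \<open>2b = n\<close> (or \<open>2a = n\<close>) makes \<open>a\<close> (or \<open>b\<close>) a divisor of \<open>2\<close>. In each of the resulting cases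
  \<open>r\<close> is determined up to a factor \<open>2\<close>, and the bound \<open>r \<le> 2\<close> selects the listed values.\<close>

lemma Lambda_indices:
  assumes \<Lambda>: "(n, a, b, r) \<in> Lambda_set n" and n: "n \<ge> 2"
  shows "a \<noteq> n"
    and "2 * a = n \<and> (r = 1 \<or> r = 2) \<longleftrightarrow> (n, a, b, r) = (2, 1, 2, 1) \<or> (n, a, b, r) = (2, 1, 1, 2)"
    and "(b = n \<or> 2 * b = n) \<and> (r = 1 \<or> r = 2) \<longleftrightarrow> (a, b, r) = (1, n, 1) \<or>
      odd n \<and> (a, b, r) = (1, n, 2) \<or> even n \<and> (a, b, r) = (1, n div 2, 2) \<or>
      even n \<and> odd (n div 2) \<and> (a, b, r) = (2, n div 2, 1)"
    and "b = n \<and> r = 1 \<longleftrightarrow> (a, b, r) = (1, n, 1)"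
proof -
  note D = Lambda_setD[OF \<Lambda>]
  have ab: "1 \<le> a" "a \<le> b" "b \<le> n" "a dvd n" "b dvd n" "coprime a b" using D n by auto
  have r: "r * (a * b) = n \<or> r * (a * b) = 2 * n \<and> odd (a * b)" using D n by auto
  have b_n: "a = 1" if "b = n" using ab that by (metis coprime_absorb_left nat_dvd_1_iff_1)
  show "a \<noteq> n" using b_n ab n by auto
  show "b = n \<and> r = 1 \<longleftrightarrow> (a, b, r) = (1, n, 1)" using b_n by auto
  show "2 * a = n \<and> (r = 1 \<or> r = 2) \<longleftrightarrow> (n, a, b, r) = (2, 1, 2, 1) \<or> (n, a, b, r) = (2, 1, 1, 2)"
  proof
    assume *: "2 * a = n \<and> (r = 1 \<or> r = 2)"
    then have "b dvd 2" using ab by (metis coprime_commute coprime_dvd_mult_left_iff)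
    then consider "b = 1" | "b = 2" using dvd_2_cases by blast
    then show "(n, a, b, r) = (2, 1, 2, 1) \<or> (n, a, b, r) = (2, 1, 1, 2)"
    proof cases
      case 1
      then have "a = 1" using ab by simp
      then show ?thesis using 1 * r by auto
    next
      case 2
      then have "a = 1" using ab by (cases "a = 2") auto
      then show ?thesis using 2 * r by auto
    qed
  qed auto
  show "(b = n \<or> 2 * b = n) \<and> (r = 1 \<or> r = 2) \<longleftrightarrow> (a, b, r) = (1, n, 1) \<or>
      odd n \<and> (a, b, r) = (1, n, 2) \<or> even n \<and> (a, b, r) = (1, n div 2, 2) \<or>
      even n \<and> odd (n div 2) \<and> (a, b, r) = (2, n div 2, 1)" (is "?l \<longleftrightarrow> ?r")
  proof
    assume l: ?l
    show ?r
    proof (cases "b = n")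
      case True
      then show ?thesis using b_n r n l by auto
    next
      case False
      then have b: "2 * b = n" using l by blast
      then have "a dvd 2" using ab by (metis coprime_dvd_mult_left_iff)
      then consider "a = 1" | "a = 2" using dvd_2_cases by blast
      then show ?thesis
      proof cases
        case 1
        then show ?thesis using b r n l by auto
      next
        case 2
        then have "odd b" using ab(6) by simp
        then show ?thesis using b r n l 2 by auto
      qed
    qed
  next
    assume ?r
    then show ?l by (auto elim: evenE)
  qed
qed

section \<open>The additional systems\<close>

text \<open>The conditions \<open>J\<close>, \<open>K\<close>, \<open>M\<close> on the indices are kept as opaque propositions, so that
  comparing the two descriptions of the set of systems is pure logic.\<close>

lemma mem_image_families:
  fixes g :: "real \<Rightarrow> 'a"
  shows "S \<in> f ` ({q. J \<and> (q = a \<or> q = b)} \<union> {q. K \<and> (q = c \<or> q = d)} \<union>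
      {q. M \<and> (\<exists>\<alpha>. - 1 < \<alpha> \<and> \<alpha> < 1 \<and> \<alpha> \<noteq> 0 \<and> q = g \<alpha>)}) \<longleftrightarrow>
    (S = f c \<or> S = f d) \<and> K \<or> (S = f a \<or> S = f b) \<and> J \<or>
    (\<exists>\<alpha>. \<alpha> \<noteq> 0 \<and> \<bar>\<alpha>\<bar> < 1 \<and> S = f (g \<alpha>)) \<and> M"
  by (auto simp: abs_less_iff)

theorem theorem5p1:
  fixes n :: nat
  assumes "n \<ge> 2"
  shows "(\<forall>a b r. (n, a, b, r) \<in> Lambda_set n \<longrightarrow>
      {S. additional_system (G_nabr n a b r) S} =
      system_given_by `
        ({q. ((a, b, r) = (1, n, 1) \<or>
              odd n \<and> (a, b, r) = (1, n, 2) \<or>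
              even n \<and> (a, b, r) = (1, n div 2, 2) \<or>
              even n \<and> odd (n div 2) \<and> (a, b, r) = (2, n div 2, 1)) \<and>
             (q = qj \<or> q = qk)} \<union>
         {q. ((n, a, b, r) = (2, 1, 2, 1) \<or> (n, a, b, r) = (2, 1, 1, 2)) \<and>
             (q = 1 \<or> q = qi)} \<union>
         {q. (a, b, r) = (1, n, 1) \<and>
             (\<exists>\<alpha>::real. - 1 < \<alpha> \<and> \<alpha> < 1 \<and> \<alpha> \<noteq> 0 \<and> q = \<alpha> *\<^sub>R qk)})) \<and>
    conjugate_in_GL (G_nabr n 1 n 1) (G_complex n) \<and>
    \<not> (\<exists>S. additional_system (G_DDD n) S) \<and>
    (even n \<and> n \<ge> 4 \<longrightarrow> \<not> (\<exists>S. additional_system (G_DDD_half n) S))"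
proof -
  define \<zeta> where "\<zeta> m = cis (pi * real m / real n)" for m
  have n: "n \<ge> 1" using assms by simp
  have om: "omega n ^ m = quat_of_complex (\<zeta> m)" for m by (simp add: omega_power \<zeta>_def)
  have unit: "cmod (\<zeta> m) = 1" for m by (simp add: \<zeta>_def)
  have sq: "quat_of_complex ((\<zeta> m)\<^sup>2) = omega n ^ (2 * m)" for m
    by (simp only: om[symmetric] quat_of_complex_power[symmetric] power_mult[symmetric] mult.commute)
  have sq_iff: "(\<zeta> m)\<^sup>2 = 1 \<longleftrightarrow> m = n" "(\<zeta> m)\<^sup>2 = - 1 \<longleftrightarrow> 2 * m = n" if "1 \<le> m" "m \<le> n" for m
    using omega_square_iff[OF that]
    by (simp_all only: sq[symmetric] quat_of_complex_eq_1_iff quat_of_complex_eq_m1_iff)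
  have omega1: "omega n = quat_of_complex (\<zeta> 1)" using om[of 1] by simp

  have systems: "{S. additional_system (G_nabr n a b r) S} =
      system_given_by `
        ({q. ((a, b, r) = (1, n, 1) \<or>
              odd n \<and> (a, b, r) = (1, n, 2) \<or>
              even n \<and> (a, b, r) = (1, n div 2, 2) \<or>
              even n \<and> odd (n div 2) \<and> (a, b, r) = (2, n div 2, 1)) \<and>
             (q = qj \<or> q = qk)} \<union>
         {q. ((n, a, b, r) = (2, 1, 2, 1) \<or> (n, a, b, r) = (2, 1, 1, 2)) \<and>
             (q = 1 \<or> q = qi)} \<union>
         {q. (a, b, r) = (1, n, 1) \<and>
             (\<exists>\<alpha>::real. - 1 < \<alpha> \<and> \<alpha> < 1 \<and> \<alpha> \<noteq> 0 \<and> q = \<alpha> *\<^sub>R qk)})"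
    if \<Lambda>: "(n, a, b, r) \<in> Lambda_set n" for a b r
  proof -
    note idx = Lambda_indices[OF \<Lambda> assms]
    note D = Lambda_setD[OF \<Lambda> n]
    have a: "1 \<le> a" "a \<le> n" and b: "1 \<le> b" "b \<le> n" using D by auto
    have h: "{omega n ^ (2 * n div r)} \<subseteq> {1, - 1} \<longleftrightarrow> r = 1 \<or> r = 2"
      "{omega n ^ (2 * n div r)} \<subseteq> {1} \<longleftrightarrow> r = 1"
      using omega_root_iff[OF n D(8)] by simp_all
    have "additional_system (G_nabr n a b r) S \<longleftrightarrow>
      (S = system_given_by 1 \<or> S = system_given_by qi) \<and> 2 * a = n \<and> (r = 1 \<or> r = 2) \<or>
      (S = system_given_by qj \<or> S = system_given_by qk) \<and> (b = n \<or> 2 * b = n) \<and> (r = 1 \<or> r = 2) \<or>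
      (\<exists>\<alpha>. \<alpha> \<noteq> 0 \<and> \<bar>\<alpha>\<bar> < 1 \<and> S = system_given_by (\<alpha> *\<^sub>R qk)) \<and> b = n \<and> r = 1" for S
    proof -
      have "h * qcnj h = 1" if "h \<in> {omega n ^ (2 * n div r)}" for h
        using that unit_quat_complex[OF unit] by (simp add: om)
      moreover have "(\<zeta> a)\<^sup>2 \<noteq> 1" using sq_iff(1)[OF a] idx(1) by simp
      ultimately show ?thesis
        unfolding G_nabr_def om[of a] om[of b] sq_iff[OF a, symmetric] sq_iff[OF b, symmetric] h(1)[symmetric]
        unfolding h(2)[symmetric] by (intro additional_system_complex_j_iff unit)
    qed
    then show ?thesis
      unfolding idx(2-4) by (intro Set.set_eqI) (simp only: mem_Collect_eq mem_image_families)
  qed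
  have no_systems: "\<not> additional_system (group_LH {1, omega n, qj, omega n * qj} H) S"
    if "qj \<in> H" "H \<subseteq> {omega n, qj}" for H S
  proof -
    have "\<not> H \<subseteq> {1, - 1}" "\<not> H \<subseteq> {1}" using that(1) by (auto simp: quat_calc)
    moreover have "h * qcnj h = 1" if "h \<in> H" for h
      using that \<open>H \<subseteq> {omega n, qj}\<close> unit_quat_units unit_quat_complex[OF unit] by (auto simp: omega1)
    moreover have "(\<zeta> 1)\<^sup>2 \<noteq> 1" using sq_iff(1)[of 1] assms by simp
    ultimately show ?thesis
      unfolding omega1 using additional_system_complex_j_iff[OF unit _ unit] by blast
  qed
  show ?thesis
  proof (intro conjI allI impI)
    show "conjugate_in_GL (G_nabr n 1 n 1) (G_complex n)" by (rule G_nabr_conjugate_complex[OF n])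
    show "\<not> (\<exists>S. additional_system (G_DDD n) S)" "\<not> (\<exists>S. additional_system (G_DDD_half n) S)"
      unfolding G_DDD_def G_DDD_half_def using no_systems by blast+
  qed (rule systems)
qed

end
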